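(* Let $p$ be a prime with $p\equiv 1\pmod 4$, and write $p=x^2+y^2$ with $x,y\in\mathbb Z$ and $x$ odd. Then $$\Big(3\Big(\frac p3\Big)-2\Big)\sum_{k=0}^{p-1}\binom{2k}k^2\frac 1{16^k}\cdot\frac p{12k+1}\equiv\Big(3\Big(\frac p3\Big)+2\Big)\sum_{k=0}^{p-1}\binom{2k}k^2\frac1{16^k}\cdot\frac p{12k+5}\equiv 4x^2-2p\pmod{p^2}.$$
   Context: $\left(\frac p3\right)$ is the Legendre symbol. Congruences are taken in the ring $\mathbb Z_p$ of rational numbers whose denominators are not divisible by $p$. *)

theory Defs
  imports Complex_Main "HOL-Number_Theory.Number_Theory"
begin

(* quotient_of returns the fraction in lowest terms with positive denominator. *)
definition Zp :: "nat \<Rightarrow> rat set"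
  where "Zp p = {q. \<not> int p dvd snd (quotient_of q)}"

definition Zp_cong :: "nat \<Rightarrow> rat \<Rightarrow> rat \<Rightarrow> rat \<Rightarrow> bool"
  where "Zp_cong p m a b \<longleftrightarrow> a \<in> Zp p \<and> b \<in> Zp p \<and> (\<exists>c\<in>Zp p. a - b = m * c)"

end

theory Submission
  imports Defs
begin

text \<open>
  Put \<open>n = (p - 1) / 2\<close>. Modulo \<open>p\<^sup>2\<close> the number \<open>(2k choose k)\<^sup>2 / 16\<^sup>k\<close> agrees with
  \<open>(-1)\<^sup>k (n choose k) (n + k choose k)\<close> for \<open>k \<le> n\<close> and vanishes for \<open>n < k < p\<close>, so that a partial
  fraction expansion turns both sums into quotients of products of arithmetic progressions.
  Such a product equals its value at \<open>p = 0\<close> times \<open>1 + p h\<close> modulo \<open>p\<^sup>2\<close> with \<open>h\<close> a combination of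
  harmonic numbers, and up to the stated factors both sums become
  \<open>(p-1)! / (s! S!)\<^sup>2 (1 + p (H\<^sub>s + 5 H\<^sub>S) / 6)\<close> with \<open>s = \<lfloor>p/12\<rfloor>\<close> and \<open>S = \<lfloor>5p/12\<rfloor>\<close>. Sorting the numbers below
  \<open>p\<close> that are \<open>1\<close> modulo \<open>4\<close> by their residues modulo \<open>3\<close> (a finite form of the triplication formula of
  the Gamma function) rewrites this in terms of \<open>r!\<^sup>4\<close> with \<open>r = (p - 1) / 4\<close>; the factor
  \<open>3\<^bsup>(p-1)/2\<^esup>\<close> that appears is the source of the Legendre symbol.

  On the other side, let \<open>a + b \<i>\<close> be the Jacobi sum of a quartic character, so that \<open>a\<^sup>2 = x\<^sup>2\<close>. Under a
  homomorphism from the Gaussian integers to the integers modulo \<open>p\<^sup>2\<close>, one of \<open>a \<plusminus> b \<i>\<close> becomes a unit \<open>U\<close>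
  and the other one a multiple of \<open>p\<close>, whence \<open>U\<^sup>2 \<equiv> (a + b \<i>)\<^sup>2 + (a - b \<i>)\<^sup>2 = 4 x\<^sup>2 - 2 p\<close>. Evaluating
  \<open>U\<close> as a sum over Teichmueller representatives \<open>t\<^sup>p\<close> leaves only the binomial coefficients
  \<open>3rp choose (r + (p - 1) j)\<close>, which are known modulo \<open>p\<^sup>2\<close>, and gives the same expression in \<open>r!\<close>.
\<close>

section \<open>Congruences between localized integers\<close>

text \<open>\<open>Zp\<close> is defined through lowest terms, whereas closure proofs produce
  unreduced fractions. If \<open>p\<close> divided the reduced denominator, cross-multiplying would
  force it into the reduced numerator too, against coprimality.\<close>

lemma mem_Zp_iff:
  assumes "prime p"
  shows "q \<in> Zp p \<longleftrightarrow> (\<exists>a b. \<not> int p dvd b \<and> q = of_int a / of_int b)"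
proof
  assume "q \<in> Zp p"
  then show "\<exists>a b. \<not> int p dvd b \<and> q = of_int a / of_int b"
    unfolding Zp_def using quotient_of_div[of q "fst (quotient_of q)" "snd (quotient_of q)"] by auto
next
  assume "\<exists>a b. \<not> int p dvd b \<and> q = of_int a / of_int b"
  then obtain a b where ab: "\<not> int p dvd b" "q = of_int a / of_int b" by blast
  obtain n d where nd: "quotient_of q = (n, d)" by force
  have d: "d > 0" "coprime n d" using quotient_of_denom_pos[OF nd] quotient_of_coprime[OF nd] by auto
  have b0: "b \<noteq> 0" using ab by auto
  have "of_int a / of_int b = (of_int n / of_int d :: rat)" using quotient_of_div[OF nd] ab by simp
  then have "(of_int (a * d) :: rat) = of_int (n * b)" using d b0 by (simp add: field_simps)
  then have eq: "a * d = n * b" by linarith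
  have "\<not> int p dvd d"
  proof
    assume pd: "int p dvd d"
    then have "int p dvd n * b" using eq by (simp flip: eq)
    then have "int p dvd n" using ab assms by (simp add: prime_dvd_mult_iff)
    then have "is_unit (int p)" using coprime_common_divisor[OF d(2)] pd by blast
    then show False using assms by auto
  qed
  then show "q \<in> Zp p" using nd by (simp add: Zp_def)
qed

section \<open>Ring operations and units of the localization at an odd prime\<close>

locale odd_prime =
  fixes p :: nat
  assumes prime_p: "prime p" and odd_p: "odd p"
begin

abbreviation P :: rat where "P \<equiv> of_nat p"

lemma p_gt_2: "p > 2"
  using prime_ge_2_nat[OF prime_p] odd_p by (cases "p = 2") auto

lemma P_nz [simp]: "P \<noteq> 0" "p \<noteq> 0" "p > 0"
  using p_gt_2 by auto

lemma Zp_add [simp]: assumes "a \<in> Zp p" "b \<in> Zp p" shows "a + b \<in> Zp p"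
proof -
  obtain i j where 1: "\<not> int p dvd j" "a = of_int i / of_int j"
    using assms(1) mem_Zp_iff[OF prime_p] by blast
  obtain k l where 2: "\<not> int p dvd l" "b = of_int k / of_int l"
    using assms(2) mem_Zp_iff[OF prime_p] by blast
  note * = 1 2
  have "\<not> int p dvd j * l" using * prime_p by (simp add: prime_dvd_mult_iff)
  moreover have "j \<noteq> 0" "l \<noteq> 0" using * by auto
  then have "a + b = of_int (i * l + k * j) / of_int (j * l)" using * by (simp add: field_simps)
  ultimately show ?thesis using mem_Zp_iff[OF prime_p] by blast
qed

lemma Zp_mult [simp]: assumes "a \<in> Zp p" "b \<in> Zp p" shows "a * b \<in> Zp p"
proof -
  obtain i j where 1: "\<not> int p dvd j" "a = of_int i / of_int j"
    using assms(1) mem_Zp_iff[OF prime_p] by blast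
  obtain k l where 2: "\<not> int p dvd l" "b = of_int k / of_int l"
    using assms(2) mem_Zp_iff[OF prime_p] by blast
  note * = 1 2
  have "\<not> int p dvd j * l" using * prime_p by (simp add: prime_dvd_mult_iff)
  moreover have "a * b = of_int (i * k) / of_int (j * l)" using * by (simp add: field_simps)
  ultimately show ?thesis using mem_Zp_iff[OF prime_p] by blast
qed

lemma Zp_of_int_div: "\<not> int p dvd b \<Longrightarrow> of_int a / of_int b \<in> Zp p"
  using mem_Zp_iff[OF prime_p] by blast

lemma Zp_of_int [simp]: "of_int a \<in> Zp p"
  using Zp_of_int_div[of 1 a] p_gt_2 by simp

lemma Zp_of_nat [simp]: "of_nat a \<in> Zp p"
  using Zp_of_int[of "int a"] by simp

lemma Zp_0 [simp]: "0 \<in> Zp p" using Zp_of_int[of 0] by simp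
lemma Zp_1 [simp]: "1 \<in> Zp p" using Zp_of_int[of 1] by simp
lemma Zp_numeral [simp]: "numeral k \<in> Zp p" using Zp_of_int[of "numeral k"] by simp
lemma Zp_uminus [simp]: "a \<in> Zp p \<Longrightarrow> - a \<in> Zp p" using Zp_mult[OF Zp_of_int[of "- 1"], of a] by simp
lemma Zp_diff [simp]: "a \<in> Zp p \<Longrightarrow> b \<in> Zp p \<Longrightarrow> a - b \<in> Zp p" using Zp_add[of a "- b"] by simp
lemma Zp_power [simp]: "a \<in> Zp p \<Longrightarrow> a ^ k \<in> Zp p" by (induction k) auto
lemma Zp_sum [simp]: "(\<And>i. i \<in> I \<Longrightarrow> f i \<in> Zp p) \<Longrightarrow> sum f I \<in> Zp p"
  by (induction I rule: infinite_finite_induct) auto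

text \<open>The condition \<open>q \<noteq> 0\<close> is explicit because
  \<open>inverse 0 = 0\<close> would otherwise let zero pass as a unit.\<close>

definition Zp_unit :: "rat \<Rightarrow> bool"
  where "Zp_unit q \<longleftrightarrow> q \<noteq> 0 \<and> q \<in> Zp p \<and> inverse q \<in> Zp p"

lemma Zp_unitD: "Zp_unit q \<Longrightarrow> q \<noteq> 0" "Zp_unit q \<Longrightarrow> q \<in> Zp p" "Zp_unit q \<Longrightarrow> inverse q \<in> Zp p"
  by (auto simp: Zp_unit_def)

lemma unit_mult [simp]: "Zp_unit a \<Longrightarrow> Zp_unit b \<Longrightarrow> Zp_unit (a * b)"
  by (auto simp: Zp_unit_def)
lemma unit_divide [simp]: "Zp_unit a \<Longrightarrow> Zp_unit b \<Longrightarrow> Zp_unit (a / b)"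
  by (auto simp: Zp_unit_def divide_inverse)
lemma unit_1 [simp]: "Zp_unit 1" by (auto simp: Zp_unit_def)
lemma unit_uminus [simp]: "Zp_unit a \<Longrightarrow> Zp_unit (- a)" by (auto simp: Zp_unit_def)
lemma unit_power [simp]: "Zp_unit a \<Longrightarrow> Zp_unit (a ^ k)" by (induction k) auto

lemma unit_of_int: "\<not> int p dvd a \<Longrightarrow> Zp_unit (of_int a)"
  using Zp_of_int_div[of a 1] by (auto simp: Zp_unit_def divide_inverse)

lemma unit_mem [simp]: "Zp_unit q \<Longrightarrow> q \<in> Zp p" by (rule Zp_unitD)
lemma unit_div [simp]: "a \<in> Zp p \<Longrightarrow> Zp_unit q \<Longrightarrow> a / q \<in> Zp p"
  unfolding divide_inverse by (intro Zp_mult Zp_unitD(3))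

lemma unit_of_nat: "\<not> p dvd a \<Longrightarrow> Zp_unit (of_nat a)"
  using unit_of_int[of "int a"] by simp

lemma unit_of_nat_less: "0 < a \<Longrightarrow> a < p \<Longrightarrow> Zp_unit (of_nat a)"
  using unit_of_nat[of a] nat_dvd_not_less by blast

lemma unit_2 [simp]: "Zp_unit 2" using unit_of_nat_less[of 2] p_gt_2 by simp
lemma unit_4 [simp]: "Zp_unit 4" using unit_power[OF unit_2, of 2] by simp
lemma unit_16 [simp]: "Zp_unit 16" using unit_power[OF unit_2, of 4] by simp

lemma unit_fact: "m < p \<Longrightarrow> Zp_unit (fact m)"
proof (induction m)
  case (Suc m)
  have "Zp_unit (of_nat (Suc m))" using Suc.prems by (intro unit_of_nat_less) auto
  then show ?case using Suc by (simp del: of_nat_Suc)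
qed simp

text \<open>The denominator \<open>j\<close> of the cofactor is coprime to \<open>p ^ k\<close> and
  can be cleared. This makes congruences between integers and congruences in \<open>Zp p\<close>
  interchangeable.\<close>

lemma of_int_dvd_iff: "(\<exists>c\<in>Zp p. of_int a = P ^ k * c) \<longleftrightarrow> int p ^ k dvd a"
proof
  assume "\<exists>c\<in>Zp p. of_int a = P ^ k * c"
  then obtain c where c: "c \<in> Zp p" "of_int a = P ^ k * c" by blast
  then obtain i j where ij: "\<not> int p dvd j" "c = of_int i / of_int j"
    using mem_Zp_iff[OF prime_p] by blast
  have "j \<noteq> 0" using ij by auto
  then have "(of_int (a * j) :: rat) = of_int (int p ^ k * i)" using c ij by simp
  then have "a * j = int p ^ k * i" by linarith
  moreover have "coprime (int p ^ k) j" using ij prime_p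
    by (simp add: prime_imp_coprime)
  ultimately show "int p ^ k dvd a" by (metis coprime_dvd_mult_left_iff dvd_triv_left)
next
  assume "int p ^ k dvd a"
  then obtain c where "a = int p ^ k * c" by blast
  then show "\<exists>c\<in>Zp p. of_int a = P ^ k * c" by (intro bexI[of _ "of_int c"]) auto
qed

section \<open>Congruences and first-order expansions modulo the square of p\<close>

lemma Zp_cong_I: "a \<in> Zp p \<Longrightarrow> b \<in> Zp p \<Longrightarrow> c \<in> Zp p \<Longrightarrow> a - b = m * c \<Longrightarrow> Zp_cong p m a b"
  unfolding Zp_cong_def by blast
lemma Zp_cong_refl [simp]: "a \<in> Zp p \<Longrightarrow> Zp_cong p m a a"
  by (rule Zp_cong_I[of _ _ 0]) auto
lemma Zp_cong_sym: "Zp_cong p m a b \<Longrightarrow> Zp_cong p m b a"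
  unfolding Zp_cong_def using Zp_uminus by (metis minus_diff_eq mult_minus_right)
lemma Zp_cong_add: assumes "Zp_cong p m a b" "Zp_cong p m c d" shows "Zp_cong p m (a + c) (b + d)"
proof -
  obtain u v where uv: "u \<in> Zp p" "v \<in> Zp p" "a - b = m * u" "c - d = m * v"
    using assms unfolding Zp_cong_def by blast
  have "a + c - (b + d) = m * (u + v)" using uv by (simp add: algebra_simps)
  then show ?thesis using assms uv by (intro Zp_cong_I[of _ _ "u + v"]) (auto simp: Zp_cong_def)
qed
lemma Zp_cong_trans [trans]: assumes "Zp_cong p m a b" "Zp_cong p m b c" shows "Zp_cong p m a c"
proof -
  have "Zp_cong p m (a + b) (b + c)" by (rule Zp_cong_add) fact+
  then show ?thesis using assms by (auto simp: Zp_cong_def)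
qed
lemma Zp_cong_mult: assumes "Zp_cong p m a b" "Zp_cong p m c d" shows "Zp_cong p m (a * c) (b * d)"
proof -
  obtain u v where uv: "u \<in> Zp p" "v \<in> Zp p" "a - b = m * u" "c - d = m * v"
    using assms unfolding Zp_cong_def by blast
  have "a * c - b * d = (a - b) * c + b * (c - d)" by (simp add: algebra_simps)
  also have "\<dots> = m * (u * c + b * v)" using uv by (simp add: algebra_simps)
  finally show ?thesis using assms uv by (intro Zp_cong_I[of _ _ "u * c + b * v"]) (auto simp: Zp_cong_def)
qed
lemma Zp_cong_minus: "Zp_cong p m a b \<Longrightarrow> Zp_cong p m (- a) (- b)"
  using Zp_cong_mult[of m "-1" "-1" a b] by simp
lemma Zp_cong_diff: "Zp_cong p m a b \<Longrightarrow> Zp_cong p m c d \<Longrightarrow> Zp_cong p m (a - c) (b - d)"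
  using Zp_cong_add[OF _ Zp_cong_minus] by fastforce
lemma Zp_cong_sum: "(\<And>i. i \<in> I \<Longrightarrow> Zp_cong p m (f i) (g i)) \<Longrightarrow> Zp_cong p m (sum f I) (sum g I)"
  by (induction I rule: infinite_finite_induct) (auto intro: Zp_cong_add)
lemma Zp_cong_mem: "Zp_cong p m a b \<Longrightarrow> a \<in> Zp p" "Zp_cong p m a b \<Longrightarrow> b \<in> Zp p"
  by (auto simp: Zp_cong_def)

lemma Zp_cong_cancel: assumes "Zp_cong p m (a * c) (b * c)" "Zp_unit c" "a \<in> Zp p" "b \<in> Zp p"
  shows "Zp_cong p m a b"
proof -
  have "Zp_cong p m (a * c * inverse c) (b * c * inverse c)"
    using assms Zp_unitD(3) by (intro Zp_cong_mult[OF assms(1)] Zp_cong_refl)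
  then show ?thesis using Zp_unitD(1)[OF assms(2)] by (simp add: mult.assoc)
qed

text \<open>An explicit factor \<open>p\<close> raises the precision from \<open>p\<close> to
  \<open>p ^ 2\<close>; hence first-order coefficients matter only modulo \<open>p\<close>.\<close>

lemma Zp_cong_mult_P:
  assumes "Zp_cong p P a b" shows "Zp_cong p (P ^ 2) (P * a) (P * b)"
proof -
  obtain u where u: "u \<in> Zp p" "a - b = P * u"
    using assms unfolding Zp_cong_def by blast
  have "P * a - P * b = P ^ 2 * u" using u by (simp add: power2_eq_square flip: right_diff_distrib)
  then show ?thesis using assms u by (intro Zp_cong_I[of _ _ u]) (auto simp: Zp_cong_def)
qed

lemma Zp_cong_of_int: "Zp_cong p (P ^ k) (of_int a) (of_int b) \<longleftrightarrow> [a = b] (mod int p ^ k)"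
  using of_int_dvd_iff[of "a - b" k] by (auto simp: Zp_cong_def cong_iff_dvd_diff)

lemma Zp_cong_P_of_int: "Zp_cong p P (of_int a) (of_int b) \<longleftrightarrow> [a = b] (mod int p)"
  using Zp_cong_of_int[of 1] by simp

text \<open>\<open>approx1 X Y h\<close> records the first-order expansion \<open>X \<equiv> Y (1 + p h)\<close> modulo \<open>p\<^sup>2\<close> between units, so
  that products and quotients of such quantities turn into sums and differences of the exponents \<open>h\<close>.\<close>

definition approx1 :: "rat \<Rightarrow> rat \<Rightarrow> rat \<Rightarrow> bool"
  where "approx1 X Y h \<longleftrightarrow> Zp_unit X \<and> Zp_unit Y \<and> h \<in> Zp p \<and> Zp_cong p (P ^ 2) X (Y * (1 + P * h))"

text \<open>With \<open>h = i / j\<close> the numerator becomes \<open>j + p * i\<close>, which is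
  congruent to \<open>j\<close> modulo \<open>p\<close>.\<close>

lemma unit_one_plus:
  assumes "h \<in> Zp p" shows "Zp_unit (1 + P * h)"
proof -
  obtain i j where ij: "\<not> int p dvd j" "h = of_int i / of_int j"
    using mem_Zp_iff[OF prime_p] assms by blast
  have "j \<noteq> 0" using ij by auto
  then have "1 + P * h = of_int (j + int p * i) / of_int j" using ij by (simp add: field_simps)
  moreover have "\<not> int p dvd j + int p * i" using ij(1) by (simp add: dvd_add_left_iff)
  ultimately show ?thesis using unit_of_int ij by (metis unit_divide)
qed

lemma approx1_refl: "Zp_unit X \<Longrightarrow> approx1 X X 0"
  by (simp add: approx1_def)

lemma approx1_cong: assumes "approx1 X Y h" "Zp_cong p P h k" shows "approx1 X Y k"
proof -
  have "Zp_cong p (P ^ 2) (Y * (1 + P * h)) (Y * (1 + P * k))"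
    using assms by (intro Zp_cong_mult Zp_cong_add Zp_cong_mult_P Zp_cong_refl) (auto simp: approx1_def)
  then show ?thesis using assms Zp_cong_trans Zp_cong_mem unfolding approx1_def by blast
qed

lemma approx1_mult: assumes "approx1 X Y h" "approx1 X' Y' k" shows "approx1 (X * X') (Y * Y') (h + k)"
proof -
  have "Zp_cong p (P ^ 2) (X * X') (Y * (1 + P * h) * (Y' * (1 + P * k)))"
    using assms by (intro Zp_cong_mult) (auto simp: approx1_def)
  \<comment> \<open>The cross term of the two expansions carries the factor
    \<open>p ^ 2\<close>.\<close>
  also have "Zp_cong p (P ^ 2) \<dots> (Y * Y' * (1 + P * (h + k)))"
    using assms by (intro Zp_cong_I[of _ _ "Y * Y' * h * k"])
      (auto simp: approx1_def, simp add: algebra_simps power2_eq_square)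
  finally show ?thesis using assms by (auto simp: approx1_def)
qed

lemma approx1_trans: assumes "approx1 X Y h" "approx1 Y Z k" shows "approx1 X Z (h + k)"
proof -
  have "approx1 (X * Y) (Y * Z) (h + k)" using assms by (rule approx1_mult)
  then have *: "Zp_unit Y" "Zp_cong p (P ^ 2) (X * Y) (Z * (1 + P * (h + k)) * Y)" "h + k \<in> Zp p"
    "Zp_unit X" "Zp_unit Z"
    using assms by (auto simp: approx1_def algebra_simps)
  then show ?thesis using Zp_cong_cancel[of _ X Y] by (simp add: approx1_def)
qed

lemma approx1_sym: assumes "approx1 X Y h" shows "approx1 Y X (- h)"
proof -
  have "Zp_cong p (P ^ 2) (X * (1 + P * (- h))) (Y * (1 + P * h) * (1 + P * (- h)))"
    using assms by (intro Zp_cong_mult) (auto simp: approx1_def)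
  also have "Zp_cong p (P ^ 2) \<dots> Y"
    using assms by (intro Zp_cong_I[of _ _ "- Y * h * h"])
      (auto simp: approx1_def, simp add: algebra_simps power2_eq_square)
  finally show ?thesis using assms by (auto simp: approx1_def intro: Zp_cong_sym)
qed

lemma approx1_div: assumes "approx1 X Y h" "approx1 X' Y' k" shows "approx1 (X / X') (Y / Y') (h - k)"
proof -
  have u: "Zp_unit X'" "Zp_unit Y'" "Zp_unit X" "Zp_unit Y" using assms by (auto simp: approx1_def)
  then have n: "X' \<noteq> 0" "Y' \<noteq> 0" by (auto dest: Zp_unitD(1))
  have "approx1 (1 / (X' * Y')) (1 / (X' * Y')) 0" using u by (intro approx1_refl) simp
  from approx1_mult[OF approx1_mult[OF assms(1) approx1_sym[OF assms(2)]] this]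
  show ?thesis using n by (simp add: field_simps)
qed

lemma approx1_power: assumes "approx1 X Y h" shows "approx1 (X ^ k) (Y ^ k) (of_nat k * h)"
proof (induction k)
  case 0 then show ?case by (simp add: approx1_refl)
next
  case (Suc k) from approx1_mult[OF assms this] show ?case by (simp add: algebra_simps)
qed

lemma approx1_prod:
  assumes "\<And>i. i \<in> I \<Longrightarrow> approx1 (f i) (g i) (h i)"
  shows "approx1 (prod f I) (prod g I) (sum h I)"
  using assms
  by (induction I rule: infinite_finite_induct) (auto intro: approx1_mult approx1_refl)

text \<open>Pulling out \<open>c * i\<close> leaves exactly
  \<open>1 + p * (d / (c * i))\<close>.\<close>

lemma approx1_linear:
  assumes "Zp_unit c" "Zp_unit i" "d \<in> Zp p"
  shows "approx1 (c * i + d * P) (c * i) (d / c * (1 / i))"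
proof -
  have n: "c \<noteq> 0" "i \<noteq> 0" using assms by (auto dest: Zp_unitD(1))
  have m: "d / c * (1 / i) \<in> Zp p" using assms by simp
  have eq: "c * i + d * P = c * i * (1 + P * (d / c * (1 / i)))" using n by (simp add: field_simps)
  have "Zp_unit (c * i * (1 + P * (d / c * (1 / i))))" using assms m by (intro unit_mult unit_one_plus)
  then show ?thesis unfolding approx1_def eq using assms m by auto
qed

lemma approx1_prod_linear:
  assumes "Zp_unit c" "d \<in> Zp p" "finite I" "\<And>i. i \<in> I \<Longrightarrow> Zp_unit (f i)"
  shows "approx1 (\<Prod>i\<in>I. c * f i + d * P) (c ^ card I * prod f I) (d / c * (\<Sum>i\<in>I. 1 / f i))"
proof -
  have "approx1 (\<Prod>i\<in>I. c * f i + d * P) (\<Prod>i\<in>I. c * f i) (\<Sum>i\<in>I. d / c * (1 / f i))"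
    using assms by (intro approx1_prod approx1_linear) auto
  then show ?thesis by (simp add: prod.distrib sum_distrib_left)
qed

lemma approx1_eqI:
  "approx1 X Y h \<Longrightarrow> X = X' \<Longrightarrow> Y = Y' \<Longrightarrow> h = h' \<Longrightarrow> approx1 X' Y' h'"
  by simp

text \<open>Congruence to the unit \<open>Z\<close> modulo \<open>p ^ 2\<close> makes
  \<open>X\<close> a unit as well, since \<open>X / Z\<close> has the form
  \<open>1 + p * h\<close>.\<close>

lemma approx1_cong_left:
  assumes "Zp_cong p (P ^ 2) X Z" "approx1 Z Y h" shows "approx1 X Y h"
proof -
  obtain k where k: "k \<in> Zp p" "X - Z = P ^ 2 * k" using assms(1) unfolding Zp_cong_def by blast
  have uZ: "Zp_unit Z" using assms(2) unfolding approx1_def by simp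
  have "X = Z * (1 + P * (P * k / Z))"
    using k(2) Zp_unitD(1)[OF uZ] by (simp add: field_simps power2_eq_square)
  moreover have "Zp_unit (Z * (1 + P * (P * k / Z)))" using uZ k(1) by (intro unit_mult unit_one_plus) auto
  ultimately have "Zp_unit X" by simp
  then show ?thesis using assms Zp_cong_trans unfolding approx1_def by blast
qed

lemma approx1_one_plus: "h \<in> Zp p \<Longrightarrow> approx1 (1 + P * h) 1 h"
  unfolding approx1_def by (simp add: unit_one_plus)

lemma approx1_0_cong: "approx1 X Y 0 \<Longrightarrow> Zp_cong p (P ^ 2) X Y"
  unfolding approx1_def by simp

lemma unit_not_dvd: assumes "Zp_unit (of_int a)" shows "\<not> int p dvd a"
proof
  assume "int p dvd a"
  then obtain c where c: "a = int p * c" by blast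
  have "of_int 1 = P ^ 1 * (of_int c * inverse (of_int a))"
    using Zp_unitD(1)[OF assms] unfolding c by (auto simp: field_simps)
  moreover have "of_int c * inverse (of_int a) \<in> Zp p" using Zp_unitD(3)[OF assms] by simp
  ultimately have "int p ^ 1 dvd 1" unfolding of_int_dvd_iff[symmetric] by blast
  then show False using p_gt_2 by simp
qed

end

section \<open>Factorials and harmonic numbers modulo the square of a prime\<close>

definition harmonic :: "nat \<Rightarrow> rat"
  where "harmonic m = (\<Sum>i\<in>{0<..m}. 1 / of_nat i)"

lemma greaterThanAtMost_Suc: "a \<le> m \<Longrightarrow> {a<..Suc m} = insert (Suc m) {a<..m}"
  by auto

lemma harmonic_0 [simp]: "harmonic 0 = 0"
  by (simp add: harmonic_def)

lemma harmonic_Suc: "harmonic (Suc m) = harmonic m + 1 / of_nat (Suc m)"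
  by (simp add: harmonic_def greaterThanAtMost_Suc)

lemma sum_inverse_greaterThanAtMost:
  assumes "a \<le> m" shows "(\<Sum>i\<in>{a<..m}. 1 / of_nat i) = harmonic m - harmonic a"
  using assms by (induction m rule: dec_induct) (simp_all add: greaterThanAtMost_Suc harmonic_Suc)

lemma prod_greaterThanAtMost:
  assumes "a \<le> m" shows "(\<Prod>i\<in>{a<..m}. of_nat i) = (fact m / fact a :: rat)"
  using assms by (induction m rule: dec_induct) (simp_all add: greaterThanAtMost_Suc)

lemma prod_reverse_greaterThanAtMost:
  fixes g :: "nat \<Rightarrow> rat"
  assumes "s \<le> m" shows "(\<Prod>q<s. g (m - q)) = (\<Prod>i\<in>{m - s<..m}. g i)"
  using assms
proof (induction s)
  case (Suc s)
  have "{m - Suc s<..m} = insert (m - s) {m - s<..m}" using Suc.prems by auto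
  then show ?case using Suc by simp
qed simp

lemma prod_lessThan_mult_3:
  fixes f :: "nat \<Rightarrow> rat"
  shows "(\<Prod>y<3 * s. f y) = (\<Prod>q<s. f (3 * q)) * (\<Prod>q<s. f (3 * q + 1)) * (\<Prod>q<s. f (3 * q + 2))"
  by (induction s) (simp_all add: eval_nat_numeral algebra_simps)

context odd_prime
begin

lemma harmonic_mem [simp]: "m < p \<Longrightarrow> harmonic m \<in> Zp p"
  unfolding harmonic_def by (intro Zp_sum unit_div unit_of_nat_less) auto

text \<open>The factor with index \<open>i\<close> contributes \<open>d / (c * i)\<close> to the
  exponent, so the exponents add up to a difference of harmonic numbers. Products elsewhere keep
  coefficients such as \<open>1 *\<close> and \<open>(- 1) *\<close> so that this rule matches
  them.\<close>

lemma approx1_prod_interval: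
  assumes "Zp_unit c" "d \<in> Zp p" "a \<le> m" "m < p"
  shows "approx1 (\<Prod>i\<in>{a<..m}. c * of_nat i + d * P) (c ^ (m - a) * (fact m / fact a))
    (d / c * (harmonic m - harmonic a))"
proof -
  have "approx1 (\<Prod>i\<in>{a<..m}. c * of_nat i + d * P) (c ^ card {a<..m} * (\<Prod>i\<in>{a<..m}. of_nat i))
    (d / c * (\<Sum>i\<in>{a<..m}. 1 / of_nat i))"
    using assms by (intro approx1_prod_linear unit_of_nat_less) auto
  then show ?thesis
    using assms by (simp add: prod_greaterThanAtMost sum_inverse_greaterThanAtMost)
qed

text \<open>The last \<open>m\<close> factors of \<open>fact (p - 1)\<close> are
  \<open>p - i\<close> for \<open>i = 1, ..., m\<close>.\<close>

lemma fact_mult_prod_reverse: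
  "m < p \<Longrightarrow> fact (p - 1 - m) * (\<Prod>i\<in>{0<..m}. (- 1) * of_nat i + 1 * P) = (fact (p - 1) :: rat)"
proof (induction m)
  case (Suc m)
  define k where "k = p - 1 - Suc m"
  have k: "p - 1 - m = Suc k" "p = k + m + 2" using Suc.prems by (auto simp: k_def)
  have "fact k * (\<Prod>i\<in>{0<..Suc m}. (- 1) * of_nat i + 1 * P)
      = fact (p - 1 - m) * (\<Prod>i\<in>{0<..m}. (- 1) * of_nat i + 1 * P)"
    unfolding k(1) by (simp add: k(2) greaterThanAtMost_Suc algebra_simps)
  then show ?case using Suc unfolding k_def by simp
qed simp

text \<open>The factors \<open>p - i\<close> are expanded around \<open>- i\<close>. The result
  trades the factorial of \<open>p - 1 - m\<close> for that of \<open>m\<close>.\<close>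

lemma approx1_fact_reflect:
  assumes "m < p"
  shows "approx1 (fact (p - 1)) ((- 1) ^ m * (fact (p - 1 - m) * fact m)) (- harmonic m)"
proof -
  have u: "Zp_unit (fact (p - 1 - m))" by (rule unit_fact) (use p_gt_2 in auto)
  have "approx1 (\<Prod>i\<in>{0<..m}. (- 1) * of_nat i + 1 * P) ((- 1) ^ (m - 0) * (fact m / fact 0))
    (1 / (- 1) * (harmonic m - harmonic 0))"
    using assms by (intro approx1_prod_interval) auto
  from approx1_mult[OF approx1_refl[OF u] this]
  show ?thesis unfolding fact_mult_prod_reverse[OF assms] by (simp add: mult_ac)
qed

text \<open>Modulo \<open>p\<close> the reciprocals of \<open>p - j\<close> and \<open>- j\<close>
  agree, so each term removed at the top of \<open>harmonic (p - 1)\<close> amounts to adding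
  \<open>1 / j\<close>.\<close>

lemma harmonic_reflect_aux:
  "m < p \<Longrightarrow> Zp_cong p P (harmonic (p - 1 - m)) (harmonic (p - 1) + harmonic m)"
proof (induction m)
  case 0
  then show ?case by (simp add: p_gt_2)
next
  case (Suc m)
  define k where "k = p - 1 - Suc m"
  have k: "p - 1 - m = Suc k" "p = Suc k + Suc m" using Suc.prems by (auto simp: k_def)
  have u: "Zp_unit (of_nat (Suc k))" "Zp_unit (of_nat (Suc m))"
    using k by (intro unit_of_nat_less; simp)+
  have "Zp_cong p P (harmonic (Suc k) - 1 / of_nat (Suc k)) (harmonic (p - 1) + harmonic m + 1 / of_nat (Suc m))"
  proof -
    have "Zp_cong p P (- (1 / of_nat (Suc k))) (1 / of_nat (Suc m))"
    proof (rule Zp_cong_I)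
      have "P = of_nat (Suc k) + of_nat (Suc m)" using k(2) by simp
      then show "- (1 / of_nat (Suc k)) - 1 / of_nat (Suc m) = P * (- (1 / (of_nat (Suc k) * of_nat (Suc m))))"
        using Zp_unitD(1)[OF u(1)] Zp_unitD(1)[OF u(2)] by (simp add: divide_simps del: of_nat_Suc)
    qed (use u in \<open>auto simp del: of_nat_Suc\<close>)
    moreover have "Zp_cong p P (harmonic (Suc k)) (harmonic (p - 1) + harmonic m)"
      using Suc unfolding k by simp
    ultimately show ?thesis using Zp_cong_add by fastforce
  qed
  then show ?case unfolding k_def[symmetric] by (simp add: harmonic_Suc add.assoc)
qed

text \<open>The auxiliary reflection at \<open>m = p - 1\<close> says that \<open>0\<close> is
  congruent to twice the number in question, and 2 is a unit.\<close>

lemma harmonic_p_minus_1: "Zp_cong p P (harmonic (p - 1)) 0"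
proof -
  have "Zp_cong p P (harmonic (p - 1 - (p - 1))) (harmonic (p - 1) + harmonic (p - 1))"
    using p_gt_2 by (intro harmonic_reflect_aux) auto
  then have "Zp_cong p P (0 * 2) (harmonic (p - 1) * 2)" by (simp add: mult_2_right)
  then have "Zp_cong p P 0 (harmonic (p - 1))"
    by (rule Zp_cong_cancel) (use p_gt_2 in auto)
  then show ?thesis by (rule Zp_cong_sym)
qed

lemma harmonic_reflect:
  assumes "m < p" shows "Zp_cong p P (harmonic (p - 1 - m)) (harmonic m)"
proof -
  have "Zp_cong p P (harmonic (p - 1) + harmonic m) (0 + harmonic m)"
    using assms by (intro Zp_cong_add harmonic_p_minus_1 Zp_cong_refl) simp
  then show ?thesis using harmonic_reflect_aux[OF assms] Zp_cong_trans by fastforce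
qed

section \<open>Products over residue classes modulo 3\<close>

lemma unit_3: "p \<noteq> 3 \<Longrightarrow> Zp_unit 3"
  using p_gt_2 unit_of_nat_less[of 3] by simp

lemma unit_12: "p \<noteq> 3 \<Longrightarrow> Zp_unit 12"
  using unit_mult[OF unit_4 unit_3] by simp

text \<open>The numbers below \<open>p\<close> are sorted modulo 3: those congruent to
  \<open>p\<close> are \<open>p - 3 * i\<close>, those congruent to \<open>2 * p\<close> are
  \<open>2 * p - 3 * i\<close>, and the multiples of 3 give \<open>3 ^ t * fact t\<close>.\<close>

lemma fact_split_mod_3:
  assumes "p \<noteq> 3"
  defines "t \<equiv> p div 3"
  shows "fact (p - 1) = (\<Prod>i\<in>{0<..t}. (- 3) * of_nat i + 1 * P) *
    (\<Prod>i\<in>{t<..p - 1 - t}. (- 3) * of_nat i + 2 * P) * (3 ^ t * fact t)"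
proof -
  have "\<not> 3 dvd p" using assms(1) prime_p by (auto simp: prime_nat_iff)
  then have "p = 3 * t + 1 \<or> p = 3 * t + 2" unfolding t_def by presburger
  then consider "p = 3 * t + 1" | "p = 3 * t + 2" by blast
  moreover have fct: "fact (p - 1) = (\<Prod>y<p - 1. of_nat (y + 1) :: rat)"
    by (induction "p - 1") (auto simp: fact_prod_Suc atLeast0LessThan)
  moreover have third: "(\<Prod>q<t. of_nat (3 * q + 2 + 1) :: rat) = 3 ^ t * fact t" for t
    by (induction t) (auto simp: algebra_simps)
  ultimately show ?thesis
  proof cases
    case 1
    have "(\<Prod>q<t. of_nat (3 * q + 1) :: rat) = (\<Prod>q<t. (- 3) * of_nat (t - q) + 1 * P)"
      by (intro prod.cong) (auto simp: 1 of_nat_diff)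
    also have "\<dots> = (\<Prod>i\<in>{t - t<..t}. (- 3) * of_nat i + 1 * P)"
      by (rule prod_reverse_greaterThanAtMost) simp
    finally have A: "(\<Prod>q<t. of_nat (3 * q + 1) :: rat) = (\<Prod>i\<in>{0<..t}. (- 3) * of_nat i + 1 * P)" by simp
    have "(\<Prod>q<t. of_nat (3 * q + 1 + 1) :: rat) = (\<Prod>q<t. (- 3) * of_nat (2 * t - q) + 2 * P)"
      by (intro prod.cong) (auto simp: 1 of_nat_diff)
    also have "\<dots> = (\<Prod>i\<in>{2 * t - t<..2 * t}. (- 3) * of_nat i + 2 * P)"
      by (rule prod_reverse_greaterThanAtMost) simp
    finally have B: "(\<Prod>q<t. of_nat (3 * q + 1 + 1) :: rat) = (\<Prod>i\<in>{t<..p - 1 - t}. (- 3) * of_nat i + 2 * P)"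
      using 1 by (simp add: mult_2)
    have "fact (p - 1) = (\<Prod>y<3 * t. of_nat (y + 1) :: rat)" using fct 1 by simp
    then show ?thesis unfolding prod_lessThan_mult_3 A B third .
  next
    case 2
    have "(\<Prod>q<t. of_nat (3 * q + 1 + 1) :: rat) = (\<Prod>q<t. (- 3) * of_nat (t - q) + 1 * P)"
      by (intro prod.cong) (auto simp: 2 of_nat_diff)
    also have "\<dots> = (\<Prod>i\<in>{t - t<..t}. (- 3) * of_nat i + 1 * P)"
      by (rule prod_reverse_greaterThanAtMost) simp
    finally have A: "(\<Prod>q<t. of_nat (3 * q + 1 + 1) :: rat) = (\<Prod>i\<in>{0<..t}. (- 3) * of_nat i + 1 * P)" by simp
    have "(\<Prod>q<Suc t. of_nat (3 * q + 1) :: rat) = (\<Prod>q<Suc t. (- 3) * of_nat (2 * t + 1 - q) + 2 * P)"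
      by (intro prod.cong) (auto simp: 2 of_nat_diff)
    also have "\<dots> = (\<Prod>i\<in>{2 * t + 1 - Suc t<..2 * t + 1}. (- 3) * of_nat i + 2 * P)"
      by (rule prod_reverse_greaterThanAtMost) simp
    finally have B: "(\<Prod>q<Suc t. of_nat (3 * q + 1) :: rat) = (\<Prod>i\<in>{t<..p - 1 - t}. (- 3) * of_nat i + 2 * P)"
      using 2 by (simp add: mult_2)
    have "fact (p - 1) = (\<Prod>y<3 * t. of_nat (y + 1) :: rat) * of_nat (3 * t + 1)" using fct 2 by simp
    also have "\<dots> = (\<Prod>q<Suc t. of_nat (3 * q + 1)) * (\<Prod>q<t. of_nat (3 * q + 1 + 1)) * (\<Prod>q<t. of_nat (3 * q + 2 + 1))"
      unfolding prod_lessThan_mult_3 by (simp add: mult_ac)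
    finally show ?thesis unfolding A B third by (simp add: mult_ac)
  qed
qed

text \<open>Comparing \<open>fact_split_mod_3\<close> with the reflection of
  \<open>fact (p - 1)\<close> at \<open>t\<close> cancels all factorials. The outcome is the
  classical expression of the Fermat quotient of 3 by a harmonic number.\<close>

lemma approx1_power_3:
  assumes "p \<noteq> 3"
  defines "t \<equiv> p div 3"
  shows "approx1 (3 ^ (p - 1)) 1 (- (2 / 3 * harmonic t))"
proof -
  have u3: "Zp_unit (- 3)" "Zp_unit 3" using unit_3[OF assms(1)] by auto
  have t: "t < p" "t \<le> p - 1 - t" "p - 1 - t < p" unfolding t_def using p_gt_2 by auto
  have ut: "Zp_unit (fact t)" "Zp_unit (fact (p - 1 - t))" using unit_fact[OF t(1)] unit_fact[OF t(3)] by simp_all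
  have 1: "approx1 (\<Prod>i\<in>{0<..t}. (- 3) * of_nat i + 1 * P) ((- 3) ^ (t - 0) * (fact t / fact 0))
      (1 / (- 3) * (harmonic t - harmonic 0))"
    by (rule approx1_prod_interval[OF u3(1) Zp_1 le0 t(1)])
  have 2: "approx1 (\<Prod>i\<in>{t<..p - 1 - t}. (- 3) * of_nat i + 2 * P)
      ((- 3) ^ (p - 1 - t - t) * (fact (p - 1 - t) / fact t))
      (2 / (- 3) * (harmonic (p - 1 - t) - harmonic t))"
    using t u3 by (intro approx1_prod_interval) auto
  have "Zp_cong p P (2 / (- 3) * (harmonic (p - 1 - t) - harmonic t)) (2 / (- 3) * (harmonic t - harmonic t))"
    using t(1) u3 by (intro Zp_cong_mult Zp_cong_diff harmonic_reflect Zp_cong_refl unit_div) auto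
  from approx1_mult[OF approx1_mult[OF 1 approx1_cong[OF 2 this]] approx1_refl[of "3 ^ t * fact t"]]
  have "approx1 (fact (p - 1)) ((- 3) ^ t * fact t * ((- 3) ^ (p - 1 - t - t) * (fact (p - 1 - t) / fact t)) * (3 ^ t * fact t))
     (- (harmonic t / 3))"
    unfolding fact_split_mod_3[OF assms(1), folded t_def] using ut u3 by simp
  moreover have "(- 3) ^ t * fact t * ((- 3) ^ (p - 1 - t - t) * (fact (p - 1 - t) / fact t)) * (3 ^ t * fact t)
      = 3 ^ (p - 1) * ((- 1) ^ t * (fact (p - 1 - t) * fact t :: rat))"
  proof -
    have e: "even (p - 1)" using odd_p p_gt_2 by auto
    have "(- 3) ^ t * (- 3 :: rat) ^ (p - 1 - t - t) = (- 3) ^ (p - 1 - t)"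
      using le_add_diff_inverse[OF t(2)] by (simp only: power_add[symmetric])
    moreover have "(- 3 :: rat) ^ (p - 1 - t) = (- 1) ^ (p - 1 - t) * 3 ^ (p - 1 - t)"
      by (rule power_minus)
    moreover have "3 ^ (p - 1 - t) * 3 ^ t = (3 :: rat) ^ (p - 1)"
    proof -
      have "p - 1 - t + t = p - 1" using t(2) by simp
      then show ?thesis by (simp only: power_add[symmetric])
    qed
    moreover have "(- 1 :: rat) ^ (p - 1 - t) = (- 1) ^ t"
      using e t by (auto simp: minus_one_power_iff)
    ultimately show ?thesis by (simp add: field_simps)
  qed
  ultimately have "approx1 (fact (p - 1)) (3 ^ (p - 1) * ((- 1) ^ t * (fact (p - 1 - t) * fact t))) (- (harmonic t / 3))"
    by (simp only:)
  from approx1_div[OF approx1_fact_reflect[OF t(1)] this]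
  have "approx1 1 (1 / 3 ^ (p - 1)) (- harmonic t + harmonic t / 3)"
    using Zp_unitD(1)[OF unit_fact[of "p - 1"]] Zp_unitD(1)[OF ut(1)] Zp_unitD(1)[OF ut(2)]
    by (simp add: divide_simps)
  from approx1_mult[OF approx1_refl[of "3 ^ (p - 1)"] this] show ?thesis
    using u3 by (simp add: field_simps)
qed

text \<open>The left side runs over the numbers \<open>4 * y + 1\<close> below \<open>p\<close>.
  Those congruent to \<open>p\<close> modulo 12 are \<open>p - 12 * i\<close>, those congruent to
  \<open>5 * p\<close> are \<open>5 * p - 12 * i\<close>, and the multiples of 3 are
  \<open>3 * (3 * p - 4 * i)\<close>.\<close>

lemma triple_product:
  assumes "p mod 12 = 1 \<or> p mod 12 = 5"
  defines "r \<equiv> p div 4" and "s \<equiv> p div 12" and "S \<equiv> 5 * p div 12" and "t \<equiv> p div 3"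
  shows "(\<Prod>i\<in>{0<..r}. (- 4) * of_nat i + 1 * P) =
    (\<Prod>i\<in>{0<..s}. (- 12) * of_nat i + 1 * P) * (\<Prod>i\<in>{t<..S}. (- 12) * of_nat i + 5 * P) *
    (3 ^ s * (\<Prod>i\<in>{p - 1 - t<..3 * r}. (- 4) * of_nat i + 3 * P))"
proof -
  let ?f = "\<lambda>y. of_nat (4 * y + 1) :: rat"
  have lhs: "(\<Prod>i\<in>{0<..r}. (- 4) * of_nat i + 1 * P) = (\<Prod>y<r. ?f y)"
  proof -
    have "p = 4 * r + 1" using assms(1) unfolding r_def by presburger
    then have "(\<Prod>y<r. ?f y) = (\<Prod>y<r. (- 4) * of_nat (r - y) + 1 * P)"
      by (intro prod.cong) (auto simp: of_nat_diff)
    also have "\<dots> = (\<Prod>i\<in>{r - r<..r}. (- 4) * of_nat i + 1 * P)"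
      by (rule prod_reverse_greaterThanAtMost) simp
    finally show ?thesis by simp
  qed
  have sub: "(\<Prod>q<k. g q) = (\<Prod>i\<in>{m - k<..m}. d * of_nat i + c * P)"
    if "k \<le> m" "\<And>q. q < k \<Longrightarrow> g q = d * of_nat (m - q) + c * P" for k m c d and g :: "nat \<Rightarrow> rat"
    using that by (simp add: prod_reverse_greaterThanAtMost[of k m "\<lambda>i. d * of_nat i + c * P", symmetric])
  have "p = 12 * s + 1 \<or> p = 12 * s + 5" using assms(1) unfolding s_def by presburger
  then consider "p = 12 * s + 1" | "p = 12 * s + 5" by blast
  then show ?thesis
  proof cases
    case 1
    have e: "r = 3 * s" "S = 5 * s" "t = 4 * s" using 1 unfolding r_def S_def t_def by presburger+
    have A: "(\<Prod>q<s. ?f (3 * q)) = (\<Prod>i\<in>{s - s<..s}. (- 12) * of_nat i + 1 * P)"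
      by (rule sub) (auto simp: 1 of_nat_diff)
    have B: "(\<Prod>q<s. ?f (3 * q + 1)) = (\<Prod>i\<in>{5 * s - s<..5 * s}. (- 12) * of_nat i + 5 * P)"
      by (rule sub) (auto simp: 1 of_nat_diff)
    have "(\<Prod>q<s. ?f (3 * q + 2)) = (\<Prod>q<s. 3 * of_nat (4 * q + 3))"
      by (intro prod.cong) auto
    also have "\<dots> = 3 ^ s * (\<Prod>q<s. of_nat (4 * q + 3))" by (simp only: prod.distrib prod_constant card_lessThan)
    also have "(\<Prod>q<s. of_nat (4 * q + 3)) = (\<Prod>i\<in>{9 * s - s<..9 * s}. (- 4) * of_nat i + 3 * P)"
      by (rule sub) (auto simp: 1 of_nat_diff)
    finally have C: "(\<Prod>q<s. ?f (3 * q + 2)) = 3 ^ s * (\<Prod>i\<in>{9 * s - s<..9 * s}. (- 4) * of_nat i + 3 * P)" .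
    have D: "5 * s = S" "S - s = t" "9 * s = 3 * r" "3 * r - s = p - 1 - t" "s - s = 0" using e 1 by auto
    have "(\<Prod>y<r. ?f y) = (\<Prod>q<s. ?f (3 * q)) * (\<Prod>q<s. ?f (3 * q + 1)) * (\<Prod>q<s. ?f (3 * q + 2))"
      unfolding e(1) by (rule prod_lessThan_mult_3)
    then show ?thesis unfolding lhs A B C D .
  next
    case 2
    have e: "r = 3 * s + 1" "S = 5 * s + 2" "t = 4 * s + 1" using 2 unfolding r_def S_def t_def by presburger+
    \<comment> \<open>Here the classes of 1 and 5 modulo 12 exchange their roles, and since
      \<open>r = 3 * s + 1\<close> the class of 1 has one extra member.\<close>
    have A: "(\<Prod>q<s. ?f (3 * q + 1)) = (\<Prod>i\<in>{s - s<..s}. (- 12) * of_nat i + 1 * P)"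
      by (rule sub) (auto simp: 2 of_nat_diff)
    have B: "(\<Prod>q<Suc s. ?f (3 * q)) = (\<Prod>i\<in>{5 * s + 2 - Suc s<..5 * s + 2}. (- 12) * of_nat i + 5 * P)"
      by (rule sub) (auto simp: 2 of_nat_diff)
    have "(\<Prod>q<s. ?f (3 * q + 2)) = (\<Prod>q<s. 3 * of_nat (4 * q + 3))"
      by (intro prod.cong) auto
    also have "\<dots> = 3 ^ s * (\<Prod>q<s. of_nat (4 * q + 3))" by (simp only: prod.distrib prod_constant card_lessThan)
    also have "(\<Prod>q<s. of_nat (4 * q + 3)) = (\<Prod>i\<in>{9 * s + 3 - s<..9 * s + 3}. (- 4) * of_nat i + 3 * P)"
      by (rule sub) (auto simp: 2 of_nat_diff)
    finally have C: "(\<Prod>q<s. ?f (3 * q + 2)) = 3 ^ s * (\<Prod>i\<in>{9 * s + 3 - s<..9 * s + 3}. (- 4) * of_nat i + 3 * P)" .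
    have D: "5 * s + 2 = S" "S - Suc s = t" "9 * s + 3 = 3 * r" "3 * r - s = p - 1 - t" "s - s = 0" using e 2 by auto
    have "(\<Prod>y<r. ?f y) = (\<Prod>q<Suc s. ?f (3 * q)) * (\<Prod>q<s. ?f (3 * q + 1)) * (\<Prod>q<s. ?f (3 * q + 2))"
      unfolding e(1) One_nat_def add_Suc_right Nat.add_0_right prod.lessThan_Suc prod_lessThan_mult_3
      by (simp only: mult_ac)
    also have "\<dots> = (\<Prod>i\<in>{t<..S}. (- 12) * of_nat i + 5 * P) * (\<Prod>i\<in>{0<..s}. (- 12) * of_nat i + 1 * P) *
      (3 ^ s * (\<Prod>i\<in>{p - 1 - t<..3 * r}. (- 4) * of_nat i + 3 * P))"
      unfolding A B C D by (simp only: mult_ac)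
    finally show ?thesis unfolding lhs by (simp only: mult_ac)
  qed
qed

text \<open>Both sides of \<open>triple_product\<close> are expanded and the powers of
  \<open>- 4\<close> cancel. Reflection at \<open>r\<close> and \<open>t\<close> replaces
  \<open>fact r' / (fact t * fact t')\<close> by \<open>1 / fact r\<close> up to sign, and squaring
  removes the sign.\<close>

lemma approx1_triple:
  assumes "p mod 12 = 1 \<or> p mod 12 = 5"
  defines "r \<equiv> p div 4" and "s \<equiv> p div 12" and "S \<equiv> 5 * p div 12" and "t \<equiv> p div 3"
  shows "approx1 (fact r ^ 4) (3 ^ (2 * r) * (fact s * fact S) ^ 2)
    (harmonic r + harmonic t / 3 - harmonic s / 6 - 5 * harmonic S / 6)"
proof -
  define t' where "t' = p - 1 - t"
  define r' where "r' = p - 1 - r"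
  have "p = 12 * s + 1 \<or> p = 12 * s + 5" using assms(1) unfolding s_def by presburger
  then have cases: "p = 12 * s + 1 \<and> r = 3 * s \<and> S = 5 * s \<and> t = 4 * s \<and> t' = 8 * s \<and> r' = 9 * s \<or>
      p = 12 * s + 5 \<and> r = 3 * s + 1 \<and> S = 5 * s + 2 \<and> t = 4 * s + 1 \<and> t' = 8 * s + 3 \<and> r' = 9 * s + 3"
  proof (elim disjE)
    assume p: "p = 12 * s + 1"
    then have "r = 3 * s" "S = 5 * s" "t = 4 * s" unfolding r_def S_def t_def by presburger+
    then show ?thesis using p unfolding t'_def r'_def by auto
  next
    assume p: "p = 12 * s + 5"
    then have "r = 3 * s + 1" "S = 5 * s + 2" "t = 4 * s + 1" unfolding r_def S_def t_def by presburger+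
    then show ?thesis using p unfolding t'_def r'_def by auto
  qed
  have p3: "p \<noteq> 3" using assms(1) by auto
  have u: "Zp_unit 3" "Zp_unit (- 4)" "Zp_unit (- 12)" using unit_3[OF p3] unit_12[OF p3] by auto
  have le: "r < p" "s < p" "S < p" "t < p" "t' < p" "r' < p" "t \<le> S" "t' \<le> r'" using cases by auto
  have eqs: "r' = 3 * r" "r = s + (S - t) + (r' - t')" "r' - t' = s" using cases by auto
  note uf = unit_fact[OF le(1)] unit_fact[OF le(2)] unit_fact[OF le(3)] unit_fact[OF le(4)]
    unit_fact[OF le(5)] unit_fact[OF le(6)]
  note nz = uf[THEN Zp_unitD(1)]
  have 0: "approx1 (\<Prod>i\<in>{0<..r}. (- 4) * of_nat i + 1 * P) ((- 4) ^ (r - 0) * (fact r / fact 0))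
      (1 / (- 4) * (harmonic r - harmonic 0))"
    by (rule approx1_prod_interval[OF u(2) Zp_1 le0 le(1)])
  have 1: "approx1 (\<Prod>i\<in>{0<..s}. (- 12) * of_nat i + 1 * P) ((- 12) ^ (s - 0) * (fact s / fact 0))
      (1 / (- 12) * (harmonic s - harmonic 0))"
    by (rule approx1_prod_interval[OF u(3) Zp_1 le0 le(2)])
  have 2: "approx1 (\<Prod>i\<in>{t<..S}. (- 12) * of_nat i + 5 * P) ((- 12) ^ (S - t) * (fact S / fact t))
      (5 / (- 12) * (harmonic S - harmonic t))"
    by (rule approx1_prod_interval[OF u(3) Zp_numeral le(7) le(3)])
  have 3: "approx1 (\<Prod>i\<in>{t'<..r'}. (- 4) * of_nat i + 3 * P) ((- 4) ^ (r' - t') * (fact r' / fact t'))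
      (3 / (- 4) * (harmonic r' - harmonic t'))"
    by (rule approx1_prod_interval[OF u(2) Zp_numeral le(8) le(6)])
  have "Zp_cong p P (3 / (- 4) * (harmonic r' - harmonic t')) (3 / (- 4) * (harmonic r - harmonic t))"
    unfolding r'_def t'_def using le(1,4)
    by (intro Zp_cong_mult Zp_cong_diff harmonic_reflect Zp_cong_refl unit_div) auto
  note 3 = approx1_cong[OF 3 this]
  note 123 = approx1_mult[OF approx1_mult[OF 1 2] approx1_mult[OF approx1_refl[OF unit_power[OF u(1), of s]] 3]]
  have tp: "(\<Prod>i\<in>{0<..r}. (- 4) * of_nat i + 1 * P) =
    (\<Prod>i\<in>{0<..s}. (- 12) * of_nat i + 1 * P) * (\<Prod>i\<in>{t<..S}. (- 12) * of_nat i + 5 * P) *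
    (3 ^ s * (\<Prod>i\<in>{t'<..r'}. (- 4) * of_nat i + 3 * P))"
    using triple_product[OF assms(1)] unfolding r_def s_def S_def t_def t'_def eqs(1) .
  have 4: "approx1 ((- 4) ^ r * fact r)
      ((- 12) ^ s * fact s * ((- 12) ^ (S - t) * (fact S / fact t)) * (3 ^ s * ((- 4) ^ (r' - t') * (fact r' / fact t'))))
      (harmonic r / 4 - harmonic s / 12 - 5 * harmonic S / 12 + 7 * harmonic t / 6 - 3 * harmonic r / 4)"
    by (rule approx1_eqI[OF approx1_trans[OF approx1_sym[OF 0[unfolded tp]] 123]]) (simp_all add: field_simps)
  have "(- 12 :: rat) ^ s * fact s * ((- 12) ^ (S - t) * (fact S / fact t)) * (3 ^ s * ((- 4) ^ (r' - t') * (fact r' / fact t')))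
     = (- 4) ^ r * (3 ^ r * (fact s * fact S * (fact r' / (fact t * fact t')))) " (is "?l = ?r")
  proof -
    have "(- 12 :: rat) ^ k = (- 4) ^ k * 3 ^ k" for k by (simp flip: power_mult_distrib)
    then have "?l = (- 4) ^ (s + (S - t) + (r' - t')) * 3 ^ (s + (S - t) + (r' - t')) * (fact s * fact S * (fact r' / (fact t * fact t')))"
      using nz by (simp add: power_add eqs(3) mult_ac)
    then show ?thesis unfolding eqs(2)[symmetric] by (simp only: mult_ac)
  qed
  from approx1_div[OF 4[unfolded this] approx1_refl[OF unit_power[OF u(2), of r]]]
  have 5: "approx1 (fact r) (3 ^ r * (fact s * fact S * (fact r' / (fact t * fact t'))))
      (harmonic r / 4 - harmonic s / 12 - 5 * harmonic S / 12 + 7 * harmonic t / 6 - 3 * harmonic r / 4)"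
    by simp
  have 6: "approx1 ((- 1) ^ t * (fact t' * fact t)) (fact (p - 1)) (harmonic t)"
    using approx1_sym[OF approx1_fact_reflect[OF le(4)]] unfolding t'_def by simp
  have 7: "approx1 ((- 1) ^ r * (fact r' * fact r)) (fact (p - 1)) (harmonic r)"
    using approx1_sym[OF approx1_fact_reflect[OF le(1)]] unfolding r'_def by simp
  have "fact (p - 1) \<noteq> (0 :: rat)" by simp
  then have 8: "approx1 ((- 1) ^ r * (fact r' * fact r) / ((- 1) ^ t * (fact t' * fact t))) 1 (harmonic r - harmonic t)"
    using approx1_div[OF 7 6] by simp
  have u9: "Zp_unit ((- 1) ^ t * (- 1) ^ r * (3 ^ r * (fact s * fact S)) / fact r)"
    using uf u by (intro unit_divide unit_mult unit_power unit_uminus unit_1) auto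
  \<comment> \<open>The factorials of \<open>r'\<close> and \<open>t'\<close> are grouped into the
    quotient of the two reflections, whose leading term is 1.\<close>
  have eq: "(3 :: rat) ^ r * (fact s * fact S * (fact r' / (fact t * fact t'))) =
     (- 1) ^ r * (fact r' * fact r) / ((- 1) ^ t * (fact t' * fact t)) * ((- 1) ^ t * (- 1) ^ r * (3 ^ r * (fact s * fact S)) / fact r)"
    using nz by (simp add: divide_simps)
  have "approx1 (fact r) (1 * ((- 1) ^ t * (- 1) ^ r * (3 ^ r * (fact s * fact S)) / fact r))
     (harmonic r / 4 - harmonic s / 12 - 5 * harmonic S / 12 + 7 * harmonic t / 6 - 3 * harmonic r / 4 + (harmonic r - harmonic t + 0))"
    using approx1_trans[OF 5[unfolded eq] approx1_mult[OF 8 approx1_refl[OF u9]]] .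
  from approx1_power[OF approx1_mult[OF this approx1_refl[OF uf(1)]], of 2]
  have "approx1 ((fact r * fact r) ^ 2) (((- 1) ^ t * (- 1) ^ r * (3 ^ r * (fact s * fact S))) ^ 2)
     (harmonic r + harmonic t / 3 - harmonic s / 6 - 5 * harmonic S / 6)"
    using nz by (simp add: algebra_simps)
  moreover have "((- 1) ^ t * (- 1) ^ r * (3 ^ r * (fact s * fact S))) ^ 2 = (3 :: rat) ^ (2 * r) * (fact s * fact S :: rat) ^ 2"
    by (simp add: power_mult_distrib power_mult[symmetric] mult.commute)
  moreover have "(fact r * fact r :: rat) ^ 2 = fact r ^ 4"
    by (simp flip: power2_eq_square power_mult)
  ultimately show ?thesis by simp
qed

end

section \<open>The sums of the theorem\<close>

text \<open>These are the coefficients of \<open>x ^ k\<close> in \<open>P_n (1 - 2 * x)\<close>,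
  where \<open>P_n\<close> is the Legendre polynomial.\<close>

definition legendre_coeff :: "nat \<Rightarrow> nat \<Rightarrow> rat"
  where "legendre_coeff n k = (- 1) ^ k * of_nat (n choose k) * of_nat (n + k choose k)"

lemma legendre_coeff_fact:
  assumes "k \<le> n"
  shows "legendre_coeff n k = (- 1) ^ k * fact (n + k) / (fact k ^ 2 * fact (n - k))"
  using assms unfolding legendre_coeff_def
  by (simp add: binomial_fact power2_eq_square field_simps)

lemma legendre_coeff_Suc_right:
  assumes "k < n"
  shows "legendre_coeff n (Suc k) = legendre_coeff n k * (- (of_nat (n - k) * of_nat (n + k + 1)) / of_nat (k + 1) ^ 2)"
proof -
  obtain d where d: "n = Suc (k + d)" using assms less_iff_Suc_add by auto
  have "k \<le> n" "Suc k \<le> n" using assms by auto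
  note * = this[THEN legendre_coeff_fact]
  have "n - k = Suc d" "n - Suc k = d" using d by auto
  then show ?thesis unfolding * by (simp add: power2_eq_square divide_simps del: of_nat_Suc)
qed

lemma legendre_coeff_Suc_left:
  assumes "k \<le> n"
  shows "legendre_coeff (Suc n) k = legendre_coeff n k * (of_nat (n + 1 + k) / of_nat (n + 1 - k))"
proof -
  have "k \<le> Suc n" using assms by auto
  note * = legendre_coeff_fact[OF this] legendre_coeff_fact[OF assms]
  have "Suc n - k = Suc (n - k)" using assms by auto
  then show ?thesis unfolding * by (simp add: power2_eq_square divide_simps del: of_nat_Suc)
qed

lemma legendre_coeff_diag_Suc:
  "legendre_coeff (Suc n) (Suc n) = - (2 * of_nat (2 * n + 1) / of_nat (n + 1)) * legendre_coeff n n"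
proof -
  have "legendre_coeff (Suc n) (Suc n)
      = legendre_coeff n n * of_nat (2 * n + 1) * (- (2 * of_nat (n + 1)) / of_nat (n + 1) ^ 2)"
  proof -
    have "of_nat (Suc n + n + 1) = 2 * (of_nat (n + 1) :: rat)" by simp
    then have "legendre_coeff (Suc n) (Suc n)
      = legendre_coeff (Suc n) n * (- (1 * (2 * of_nat (n + 1))) / of_nat (n + 1) ^ 2)"
      using legendre_coeff_Suc_right[of n "Suc n"] by (simp del: of_nat_Suc of_nat_add)
    moreover have "n + 1 + n = 2 * n + 1" "n + 1 - n = 1" by auto
    then have "legendre_coeff (Suc n) n = legendre_coeff n n * of_nat (2 * n + 1)"
      using legendre_coeff_Suc_left[of n n] by (simp only: of_nat_1 div_by_1 order.refl)
    ultimately show ?thesis by (simp only: mult_1)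
  qed
  moreover have "of_nat (n + 1) \<noteq> (0 :: rat)" by (simp only: of_nat_eq_0_iff)
  moreover have "c * a * (- (2 * x) / x ^ 2) = - (2 * a / x) * c" if "x \<noteq> 0" for a c x :: rat
    using that by (simp add: power2_eq_square)
  ultimately show ?thesis by (simp only:)
qed

text \<open>Adding two neighbouring rows makes the partial sums hypergeometric, so the induction
  step is a rational identity between ratios of coefficients.\<close>

lemma legendre_coeff_telescope:
  "m \<le> n \<Longrightarrow> (\<Sum>k\<le>m. legendre_coeff (Suc n) k + legendre_coeff n k)
    = 2 * of_nat (n + m + 1) / of_nat (n + 1) * legendre_coeff n m"
proof (induction m)
  case 0
  have "of_nat (Suc n) \<noteq> (0 :: rat)" by (rule of_nat_neq_0)
  then show ?case by (simp add: legendre_coeff_def del: of_nat_Suc)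
next
  case (Suc m)
  obtain d where d: "n = Suc (m + d)" using Suc.prems less_iff_Suc_add[of m n] by auto
  have e: "Suc n - Suc m = Suc d" "n - m = Suc d" "n + 1 - Suc m = Suc d" using d by auto
  have "(\<Sum>k\<le>Suc m. legendre_coeff (Suc n) k + legendre_coeff n k)
     = 2 * of_nat (n + m + 1) / of_nat (n + 1) * legendre_coeff n m
       + legendre_coeff n (Suc m) * (of_nat (n + 1 + Suc m) / of_nat (n + 1 - Suc m) + 1)"
    using Suc by (simp add: legendre_coeff_Suc_left algebra_simps)
  also have "legendre_coeff n m = legendre_coeff n (Suc m) * (- (of_nat (m + 1) ^ 2 / (of_nat (n - m) * of_nat (n + m + 1))))"
    using Suc.prems by (simp add: legendre_coeff_Suc_right divide_simps)
  also have "2 * of_nat (n + m + 1) / of_nat (n + 1) * (legendre_coeff n (Suc m) * (- (of_nat (m + 1) ^ 2 / (of_nat (n - m) * of_nat (n + m + 1)))))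
       + legendre_coeff n (Suc m) * (of_nat (n + 1 + Suc m) / of_nat (n + 1 - Suc m) + 1)
     = 2 * of_nat (n + Suc m + 1) / of_nat (n + 1) * legendre_coeff n (Suc m)"
  proof -
    have "2 * (of_nat (n + m + 1) :: rat) / of_nat (n + 1) * (- (of_nat (m + 1) ^ 2 / (of_nat (n - m) * of_nat (n + m + 1))))
       + (of_nat (n + 1 + Suc m) / of_nat (n + 1 - Suc m) + 1) = 2 * of_nat (n + Suc m + 1) / of_nat (n + 1)"
      unfolding e(2,3) d by (simp add: divide_simps power2_eq_square) (simp add: algebra_simps)
    then show ?thesis by (simp add: algebra_simps)
  qed
  finally show ?case .
qed

text \<open>The sum is the value at \<open>- 1\<close> of two consecutive Legendre polynomials added
  together, which cancel by opposite parity. Here it follows from the closed form at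
  \<open>m = n\<close> and the diagonal ratio.\<close>

lemma sum_legendre_coeff_Suc: "(\<Sum>k\<le>n. legendre_coeff (Suc n) k + legendre_coeff n k) + legendre_coeff (Suc n) (Suc n) = 0"
  by (simp add: legendre_coeff_telescope legendre_coeff_diag_Suc mult_2[of n, symmetric] del: of_nat_Suc of_nat_add)

text \<open>For nonzero \<open>c\<close>, the left side is the partial fraction expansion of the
  right side as a rational function of \<open>b\<close>. Induction on \<open>n\<close> takes the
  place of a computation of residues.\<close>

lemma legendre_coeff_partial_fractions:
  fixes c b :: rat
  assumes "\<And>k. k \<le> n \<Longrightarrow> c * of_nat k + b \<noteq> 0"
  shows "(\<Sum>k\<le>n. legendre_coeff n k / (c * of_nat k + b))
    = (\<Prod>j\<in>{0<..n}. c * of_nat j - b) / (\<Prod>k\<le>n. c * of_nat k + b)"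
  using assms
proof (induction n)
  case 0
  then show ?case by (simp add: legendre_coeff_def)
next
  case (Suc n)
  define D where "D = c * of_nat (Suc n) + b"
  have D: "D \<noteq> 0" using Suc.prems[of "Suc n"] by (simp add: D_def)
  \<comment> \<open>Multiplying by the new denominator \<open>D\<close> splits off a part without
    denominator. Summed over \<open>k\<close> and joined by the last term, that part vanishes by
    \<open>sum_legendre_coeff_Suc\<close>.\<close>
  have term_eq: "legendre_coeff (Suc n) k / (c * of_nat k + b) * D
      = (c * of_nat (Suc n) - b) * (legendre_coeff n k / (c * of_nat k + b))
        + (legendre_coeff (Suc n) k + legendre_coeff n k)" if "k \<le> n" for k
  proof -
    have nz: "c * of_nat k + b \<noteq> 0" using Suc.prems[of k] that by simp
    have "legendre_coeff (Suc n) k * of_nat (n + 1 - k) = legendre_coeff n k * of_nat (n + 1 + k)"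
      using that by (simp add: legendre_coeff_Suc_left)
    then have "legendre_coeff (Suc n) k * (of_nat (Suc n) - of_nat k) = legendre_coeff n k * (of_nat (Suc n) + of_nat k)"
      using that by (simp add: of_nat_diff)
    then have "c * (legendre_coeff (Suc n) k * (of_nat (Suc n) - of_nat k)) = c * (legendre_coeff n k * (of_nat (Suc n) + of_nat k))"
      by simp
    then have "legendre_coeff (Suc n) k * D = (c * of_nat (Suc n) - b) * legendre_coeff n k
        + (legendre_coeff (Suc n) k + legendre_coeff n k) * (c * of_nat k + b)"
      unfolding D_def by (simp only: algebra_simps)
    then show ?thesis using nz by (simp add: field_simps)
  qed
  have "(\<Sum>k\<le>Suc n. legendre_coeff (Suc n) k / (c * of_nat k + b)) * D
     = (\<Sum>k\<le>n. legendre_coeff (Suc n) k / (c * of_nat k + b) * D) + legendre_coeff (Suc n) (Suc n)"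
    using D by (simp add: sum_distrib_right distrib_right del: of_nat_Suc flip: D_def)
  also have "(\<Sum>k\<le>n. legendre_coeff (Suc n) k / (c * of_nat k + b) * D)
     = (c * of_nat (Suc n) - b) * (\<Sum>k\<le>n. legendre_coeff n k / (c * of_nat k + b))
       + (\<Sum>k\<le>n. legendre_coeff (Suc n) k + legendre_coeff n k)"
    unfolding sum_distrib_left sum.distrib[symmetric] by (rule sum.cong[OF refl]) (simp only: term_eq atMost_iff)
  finally have "(\<Sum>k\<le>Suc n. legendre_coeff (Suc n) k / (c * of_nat k + b)) * D
     = (c * of_nat (Suc n) - b) * (\<Sum>k\<le>n. legendre_coeff n k / (c * of_nat k + b))"
    using sum_legendre_coeff_Suc[of n] by simp
  then have "(\<Sum>k\<le>Suc n. legendre_coeff (Suc n) k / (c * of_nat k + b))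
     = (c * of_nat (Suc n) - b) * (\<Sum>k\<le>n. legendre_coeff n k / (c * of_nat k + b)) / D"
    using D by (simp add: field_simps)
  also have "(\<Sum>k\<le>n. legendre_coeff n k / (c * of_nat k + b)) = (\<Prod>j\<in>{0<..n}. c * of_nat j - b) / (\<Prod>k\<le>n. c * of_nat k + b)"
    using Suc by simp
  finally show ?case by (simp add: greaterThanAtMost_Suc D_def mult_ac)
qed

lemma central_binomial_Suc:
  "(of_nat (2 * Suc k choose Suc k) :: rat) = of_nat (2 * k choose k) * (2 * of_nat (2 * k + 1) / of_nat (k + 1))"
proof -
  have *: "(of_nat (2 * m choose m) :: rat) = (- 1) ^ m * legendre_coeff m m" for m
    by (simp add: legendre_coeff_def mult_2 flip: power_add power_mult_distrib)
  show ?thesis unfolding *[of "Suc k"] *[of k] legendre_coeff_diag_Suc by simp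
qed

section \<open>Half powers of 3 and the sums modulo the square of p\<close>

context odd_prime
begin

text \<open>A square root is extracted from \<open>approx1_power_3\<close>: the square is known
  modulo \<open>p ^ 2\<close>, and Euler's criterion fixes the root modulo \<open>p\<close>. Since
  \<open>p\<close> is 1 modulo 4, reciprocity introduces no sign.\<close>

lemma approx1_power_3_half:
  assumes "p mod 4 = 1"
  shows "approx1 (3 ^ (2 * (p div 4))) (of_int (Legendre (int p) 3)) (- (harmonic (p div 3) / 3))"
proof -
  define L where "L = Legendre (int p) 3"
  define r where "r = p div 4"
  define h where "h = harmonic (p div 3) / 3"
  have pr: "p = 4 * r + 1" using assms unfolding r_def by presburger
  then have p3: "p \<noteq> 3" by presburger
  have u3: "Zp_unit 3" using unit_3[OF p3] .
  have h: "h \<in> Zp p" unfolding h_def using u3 p_gt_2 by (intro unit_div harmonic_mem) auto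
  have "prime (3 :: nat)" by simp
  then have "Legendre p 3 * Legendre 3 p = (- 1) ^ ((p - 1) div 2 * ((3 - 1) div 2))"
    using Quadratic_Reciprocity[OF prime_p p_gt_2, of 3] p3 by simp
  then have LL: "L * Legendre 3 p = 1" unfolding L_def using pr by (simp add: power_mult)
  then have L: "L = 1 \<and> Legendre 3 p = 1 \<or> L = - 1 \<and> Legendre 3 p = - 1"
    using zmult_eq_1_iff by blast
  have "[Legendre 3 p = 3 ^ ((p - 1) div 2)] (mod p)"
    by (rule euler_criterion[OF prime_p p_gt_2])
  then have "[3 ^ (2 * r) = L] (mod int p)" using L pr by (auto simp: cong_sym_eq)
  then have 1: "Zp_cong p P (3 ^ (2 * r)) (of_int L)" using Zp_cong_P_of_int[of "3 ^ (2 * r)" L] by simp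
  define Q where "Q = 3 ^ (2 * r) * (1 + P * h)"
  have "Zp_cong p P (1 + P * h) 1" using h by (intro Zp_cong_I[of _ _ h]) auto
  from Zp_cong_mult[OF 1 this] have QL: "Zp_cong p P Q (of_int L)" unfolding Q_def by simp
  have QZ: "Q \<in> Zp p" unfolding Q_def using h by simp
  have "approx1 (1 + P * h) 1 h" unfolding approx1_def using h unit_one_plus[OF h] by auto
  from approx1_mult[OF approx1_power_3[OF p3] approx1_power[OF this, of 2]]
  have "approx1 (3 ^ (p - 1) * (1 + P * h) ^ 2) 1 0" unfolding h_def by simp
  moreover have "3 ^ (p - 1) * (1 + P * h) ^ 2 = Q ^ 2"
    unfolding Q_def pr by (simp add: power_mult_distrib flip: power_mult)
  ultimately have "Zp_cong p (P ^ 2) (Q ^ 2) 1" unfolding approx1_def by simp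
  then have "Zp_cong p (P ^ 2) (Q ^ 2 - 1) (1 - 1)" by (intro Zp_cong_diff) auto
  moreover have "Q ^ 2 - 1 = (Q - of_int L) * (Q + of_int L)" using L by (auto simp: power2_eq_square algebra_simps)
  ultimately have "Zp_cong p (P ^ 2) ((Q - of_int L) * (Q + of_int L)) (0 * (Q + of_int L))" by simp
  moreover have "Zp_unit (Q + of_int L)"
  proof -
    obtain k where k: "k \<in> Zp p" "Q - of_int L = P * k" using QL unfolding Zp_cong_def by blast
    have "Q + of_int L = of_int (2 * L) * (1 + P * (k / of_int (2 * L)))"
      using k(2) L by (auto simp: field_simps)
    moreover have uL: "Zp_unit (of_int (2 * L))" using L by auto
    ultimately show ?thesis using k(1) by (metis unit_mult unit_one_plus unit_div)
  qed
  ultimately have "Zp_cong p (P ^ 2) (Q - of_int L) 0"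
    using QZ by (intro Zp_cong_cancel[of "P ^ 2" "Q - of_int L" "Q + of_int L" 0]) auto
  then have "Zp_cong p (P ^ 2) (Q - of_int L + of_int L) (0 + of_int L)" by (intro Zp_cong_add) auto
  then have 2: "Zp_cong p (P ^ 2) (of_int L) (3 ^ (2 * r) * (1 + P * h))"
    unfolding Q_def by (auto intro: Zp_cong_sym)
  have "Zp_unit (of_int L)" using L by auto
  then have "approx1 (of_int L) (3 ^ (2 * r)) h" unfolding approx1_def using 2 u3 h by simp
  from approx1_sym[OF this] show ?thesis unfolding L_def r_def h_def .
qed

text \<open>The terms in \<open>harmonic (p div 3)\<close> coming from the triplication and from the
  power of 3 cancel.\<close>

lemma approx1_fact_quarter:
  assumes "p mod 12 = 1 \<or> p mod 12 = 5"
  defines "r \<equiv> p div 4" and "s \<equiv> p div 12" and "S \<equiv> 5 * p div 12"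
  shows "approx1 (fact r ^ 4) (of_int (Legendre (int p) 3) * (fact s * fact S) ^ 2)
    (harmonic r - harmonic s / 6 - 5 * harmonic S / 6)"
proof -
  have "p mod 4 = 1" using assms(1) by presburger
  note 1 = approx1_power_3_half[OF this, folded r_def]
  have "s < p" "S < p" unfolding s_def S_def using p_gt_2 by auto
  then have u: "Zp_unit ((fact s * fact S) ^ 2)" by (intro unit_power unit_mult unit_fact)
  from approx1_trans[OF approx1_triple[OF assms(1), folded r_def s_def S_def] approx1_mult[OF 1 approx1_refl[OF u]]]
  show ?thesis by (rule approx1_eqI) simp_all
qed

text \<open>Because \<open>4 * (n - k) * (n + k + 1) = p ^ 2 - (2 * k + 1) ^ 2\<close>, the ratios
  of consecutive terms on the two sides differ by a multiple of \<open>p ^ 2\<close>.\<close>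

lemma legendre_coeff_cong:
  assumes "p = 2 * n + 1" "k \<le> n"
  shows "Zp_cong p (P ^ 2) (of_nat (2 * k choose k) ^ 2 * (1 / 16 ^ k)) (legendre_coeff n k)"
  using assms(2)
proof (induction k)
  case 0
  then show ?case by (simp add: legendre_coeff_def)
next
  case (Suc k)
  define A B :: rat where "A = of_nat (2 * k + 1) ^ 2" and "B = 4 * of_nat (k + 1) ^ 2"
  have "Zp_unit (of_nat (k + 1))" using Suc.prems assms(1) by (intro unit_of_nat_less) auto
  then have B: "Zp_unit B" unfolding B_def by (intro unit_mult unit_power) auto
  have "P = 2 * of_nat n + 1" using assms(1) by simp
  then have AP: "- (of_nat (n - k) * of_nat (n + k + 1)) * 4 = A - P ^ 2"
    using Suc.prems unfolding A_def by (simp add: of_nat_diff power2_eq_square algebra_simps)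
  have "- x * 4 / (4 * y) = - x / y" for x y :: rat by simp
  then have "- (of_nat (n - k) * of_nat (n + k + 1)) / of_nat (k + 1) ^ 2 = (A - P ^ 2) / B"
    unfolding B_def AP[symmetric] by (simp only:)
  then have 1: "legendre_coeff n (Suc k) = legendre_coeff n k * ((A - P ^ 2) / B)"
    using Suc.prems by (simp add: legendre_coeff_Suc_right)
  have 2: "of_nat (2 * Suc k choose Suc k) ^ 2 * (1 / 16 ^ Suc k)
      = of_nat (2 * k choose k) ^ 2 * (1 / 16 ^ k) * (A / B)"
    unfolding central_binomial_Suc A_def B_def
    by (simp add: power2_eq_square divide_simps) (simp add: algebra_simps)
  have "Zp_cong p (P ^ 2) (A / B) ((A - P ^ 2) / B)"
    using B by (intro Zp_cong_I[of _ _ "1 / B"]) (auto simp: A_def diff_divide_distrib)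
  then show ?case unfolding 1 2 using Suc by (intro Zp_cong_mult) auto
qed

text \<open>\<open>p\<close> divides \<open>fact (2 * k)\<close> but not \<open>fact k\<close>, so
  it divides the binomial coefficient, which occurs squared.\<close>

lemma central_binomial_cong_0:
  assumes "p \<le> 2 * k" "k < p"
  shows "Zp_cong p (P ^ 2) (of_nat (2 * k choose k) ^ 2 * (1 / 16 ^ k)) 0"
proof -
  have "fact k * fact k * (2 * k choose k) = (fact (2 * k) :: nat)"
    using binomial_fact_lemma[of k "2 * k"] by simp
  moreover have "p dvd fact (2 * k)" "\<not> p dvd fact k"
    using assms by (auto simp: prime_dvd_fact_iff[OF prime_p])
  ultimately have "p dvd 2 * k choose k" by (metis prime_dvd_mult_iff[OF prime_p])
  then obtain c where c: "2 * k choose k = p * c" by blast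
  have "Zp_unit (16 ^ k)" by (intro unit_power) simp
  then show ?thesis unfolding c
    by (intro Zp_cong_I[of _ _ "of_nat c ^ 2 * (1 / 16 ^ k)"] Zp_mult unit_div) (auto simp: power_mult_distrib)
qed

text \<open>The index \<open>m\<close> is the one whose denominator \<open>12 * m + b\<close> equals
  \<open>e * p\<close>. Counted from \<open>m\<close>, all factors of the partial fraction formula
  become \<open>12 * i\<close> or \<open>- 12 * i\<close> plus a multiple of \<open>p\<close> and
  can be expanded. The assumption \<open>integral\<close> lets congruences of coefficients survive
  multiplication by the fractions.\<close>

lemma sum_cong_partial_fractions:
  assumes n: "p = 2 * n + 1" "even n" and m: "m \<le> n" "e * p = 12 * m + b" and e: "e \<noteq> 0"
    and p3: "p \<noteq> 3" and bne: "b \<noteq> 0" and integral: "\<And>k. k < p \<Longrightarrow> of_nat e * (P / of_nat (12 * k + b)) \<in> Zp p"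
  shows "approx1 (of_nat e * (\<Sum>k = 0..p - 1. of_nat (2 * k choose k) ^ 2 * (1 / 16 ^ k) * (P / of_nat (12 * k + b))))
    (fact (p - 1) / (fact m * fact (n - m)) ^ 2)
    (harmonic (n - m) - of_nat e / 6 * (harmonic (n - m) - harmonic m))"
    (is "approx1 ?T ?Y ?h")
proof -
  define E where "E = of_nat e * P"
  have Eb: "E = 12 * of_nat m + of_nat b" unfolding E_def using arg_cong[OF m(2), of of_nat] by simp
  have nz: "12 * of_nat k + (of_nat b :: rat) \<noteq> 0" for k
  proof -
    have "12 * of_nat k + (of_nat b :: rat) = of_nat (12 * k + b)" by simp
    then show ?thesis using bne by (metis add_is_0 of_nat_eq_0_iff)
  qed
  have E0: "E \<noteq> 0" unfolding E_def using e by simp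
  define R where "R = (\<Prod>i\<in>{m<..m + n}. 12 * of_nat i + (- of_nat e) * P) /
     ((\<Prod>i\<in>{0<..m}. (- 12) * of_nat i + of_nat e * P) * (\<Prod>i\<in>{0<..n - m}. 12 * of_nat i + of_nat e * P))"
  have "Zp_cong p (P ^ 2) ?T (\<Sum>k\<le>n. legendre_coeff n k * (E / (12 * of_nat k + of_nat b)))"
  proof -
    have "?T = (\<Sum>k\<in>{..2 * n}. of_nat (2 * k choose k) ^ 2 * (1 / 16 ^ k) * (of_nat e * (P / of_nat (12 * k + b))))"
      using n(1) by (simp add: sum_distrib_left atLeast0AtMost mult_ac)
    \<comment> \<open>The terms with \<open>k > n\<close> vanish modulo \<open>p ^ 2\<close>, which
      cuts the range down to that of the partial fraction formula.\<close>
    moreover have "Zp_cong p (P ^ 2) \<dots> (\<Sum>k\<in>{..2 * n}. if k \<le> n then legendre_coeff n k * (E / (12 * of_nat k + of_nat b)) else 0)"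
    proof (rule Zp_cong_sum)
      fix k assume "k \<in> {..2 * n}"
      then have k: "k < p" using n(1) by simp
      have eq: "of_nat e * (P / of_nat (12 * k + b)) = E / (12 * of_nat k + of_nat b)"
        unfolding E_def by simp
      show "Zp_cong p (P ^ 2) (of_nat (2 * k choose k) ^ 2 * (1 / 16 ^ k) * (of_nat e * (P / of_nat (12 * k + b))))
        (if k \<le> n then legendre_coeff n k * (E / (12 * of_nat k + of_nat b)) else 0)"
      proof (cases "k \<le> n")
        case True
        have "Zp_cong p (P ^ 2) (of_nat (2 * k choose k) ^ 2 * (1 / 16 ^ k) * (of_nat e * (P / of_nat (12 * k + b))))
          (legendre_coeff n k * (of_nat e * (P / of_nat (12 * k + b))))"
          using legendre_coeff_cong[OF n(1) True] integral[OF k] by (intro Zp_cong_mult Zp_cong_refl)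
        then show ?thesis using True unfolding eq by simp
      next
        case False
        then have "p \<le> 2 * k" using n(1) by simp
        from Zp_cong_mult[OF central_binomial_cong_0[OF this k] Zp_cong_refl[OF integral[OF k]]]
        show ?thesis using False by simp
      qed
    qed
    moreover have "(\<Sum>k\<in>{..2 * n}. if k \<le> n then legendre_coeff n k * (E / (12 * of_nat k + of_nat b)) else 0)
        = (\<Sum>k\<le>n. legendre_coeff n k * (E / (12 * of_nat k + of_nat b)))"
      by (intro sum.mono_neutral_cong_right) auto
    ultimately show ?thesis by simp
  qed
  also have "(\<Sum>k\<le>n. legendre_coeff n k * (E / (12 * of_nat k + of_nat b))) = R"
  proof -
    have "(\<Sum>k\<le>n. legendre_coeff n k * (E / (12 * of_nat k + of_nat b)))
        = E * (\<Sum>k\<le>n. legendre_coeff n k / (12 * of_nat k + of_nat b))"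
      by (simp add: sum_distrib_left mult_ac)
    also have "\<dots> = E * ((\<Prod>j\<in>{0<..n}. 12 * of_nat j - of_nat b) / (\<Prod>k\<le>n. 12 * of_nat k + of_nat b))"
      using nz by (simp add: legendre_coeff_partial_fractions)
    also have "(\<Prod>j\<in>{0<..n}. 12 * of_nat j - of_nat b) = (\<Prod>i\<in>{m<..m + n}. 12 * of_nat i + (- of_nat e) * P :: rat)"
      by (rule prod.reindex_bij_witness[of _ "\<lambda>i. i - m" "\<lambda>j. j + m"])
        (use Eb in \<open>auto simp: E_def of_nat_diff algebra_simps\<close>)
    \<comment> \<open>The factor at \<open>k = m\<close> is \<open>E\<close> itself and cancels
      against the prefactor.\<close>
    also have "(\<Prod>k\<le>n. 12 * of_nat k + of_nat b) = (\<Prod>k\<in>{..<m} \<union> {m} \<union> {m<..n}. 12 * of_nat k + of_nat b :: rat)"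
      using m(1) by (intro prod.cong) auto
    also have "\<dots> = (\<Prod>k<m. 12 * of_nat k + of_nat b) * (12 * of_nat m + of_nat b) * (\<Prod>k\<in>{m<..n}. 12 * of_nat k + of_nat b)"
      by (subst prod.union_disjoint; (subst prod.union_disjoint)?) auto
    also have "(\<Prod>k<m. 12 * of_nat k + of_nat b) = (\<Prod>i\<in>{0<..m}. (- 12) * of_nat i + of_nat e * P :: rat)"
      by (rule prod.reindex_bij_witness[of _ "\<lambda>i. m - i" "\<lambda>j. m - j"])
        (use Eb in \<open>auto simp: E_def of_nat_diff algebra_simps\<close>)
    also have "(\<Prod>k\<in>{m<..n}. 12 * of_nat k + of_nat b) = (\<Prod>i\<in>{0<..n - m}. 12 * of_nat i + of_nat e * P :: rat)"
      by (rule prod.reindex_bij_witness[of _ "\<lambda>i. i + m" "\<lambda>j. j - m"])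
        (use Eb in \<open>auto simp: E_def of_nat_diff algebra_simps\<close>)
    also have "12 * of_nat m + of_nat b = E" using Eb by simp
    finally show ?thesis unfolding R_def using E0 by simp
  qed
  finally have TR: "Zp_cong p (P ^ 2) ?T R" .
  have lt: "m < p" "n - m < p" "m + n < p" "m \<le> m + n" using n m by auto
  have u12: "Zp_unit 12" "Zp_unit (- 12)" using unit_12[OF p3] by auto
  have eZ: "of_nat e \<in> Zp p" "- of_nat e \<in> Zp p" by auto
  note uf = unit_fact[OF lt(1)] unit_fact[OF lt(2)] unit_fact[OF lt(3)]
  note nzf = uf[THEN Zp_unitD(1)]
  have 1: "approx1 (\<Prod>i\<in>{m<..m + n}. 12 * of_nat i + (- of_nat e) * P) (12 ^ (m + n - m) * (fact (m + n) / fact m))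
     (- of_nat e / 12 * (harmonic (m + n) - harmonic m))"
    by (rule approx1_prod_interval[OF u12(1) eZ(2) lt(4) lt(3)])
  have 2: "approx1 (\<Prod>i\<in>{0<..m}. (- 12) * of_nat i + of_nat e * P) ((- 12) ^ (m - 0) * (fact m / fact 0))
     (of_nat e / (- 12) * (harmonic m - harmonic 0))"
    by (rule approx1_prod_interval[OF u12(2) eZ(1) le0 lt(1)])
  have 3: "approx1 (\<Prod>i\<in>{0<..n - m}. 12 * of_nat i + of_nat e * P) (12 ^ (n - m - 0) * (fact (n - m) / fact 0))
     (of_nat e / 12 * (harmonic (n - m) - harmonic 0))"
    by (rule approx1_prod_interval[OF u12(1) eZ(1) le0 lt(2)])
  \<comment> \<open>\<open>m + n\<close> and \<open>n - m\<close> are mirror indices, so both the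
    harmonic number and the factorial at \<open>m + n\<close> can be reflected.\<close>
  have mn: "m + n = p - 1 - (n - m)" using n m by auto
  have "Zp_cong p P (- of_nat e / 12 * (harmonic (m + n) - harmonic m)) (- of_nat e / 12 * (harmonic (n - m) - harmonic m))"
    unfolding mn using lt u12 by (intro Zp_cong_mult Zp_cong_diff harmonic_reflect Zp_cong_refl unit_div) auto
  note 4 = approx1_div[OF approx1_cong[OF 1 this] approx1_mult[OF 2 3]]
  have 5: "approx1 R ((- 1) ^ m * fact (m + n) / (fact m ^ 2 * fact (n - m)))
     (- of_nat e / 6 * (harmonic (n - m) - harmonic m))"
  proof (rule approx1_eqI[OF 4])
    have "(12 :: rat) ^ n = 12 ^ m * 12 ^ (n - m)" using m(1) by (simp flip: power_add)
    moreover have "(- 12 :: rat) ^ m = (- 1) ^ m * 12 ^ m" by (rule power_minus)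
    ultimately show "12 ^ (m + n - m) * (fact (m + n) / fact m) /
        ((- 12) ^ (m - 0) * (fact m / fact 0) * (12 ^ (n - m - 0) * (fact (n - m) / fact 0))) =
        (- 1) ^ m * fact (m + n) / (fact m ^ 2 * fact (n - m) :: rat)"
      by (simp add: divide_simps power2_eq_square)
  qed (simp_all add: R_def field_simps)
  have 6: "approx1 ((- 1) ^ (n - m) * (fact (m + n) * fact (n - m))) (fact (p - 1)) (harmonic (n - m))"
    using approx1_sym[OF approx1_fact_reflect[OF lt(2)]] unfolding mn[symmetric] by simp
  have "Zp_unit ((- 1) ^ (n - m) * (- 1) ^ m / (fact m * fact (n - m)) ^ 2)"
    using uf by (intro unit_divide unit_mult unit_power) auto
  from approx1_mult[OF 6 approx1_refl[OF this]]
  have "approx1 ((- 1) ^ m * fact (m + n) / (fact m ^ 2 * fact (n - m))) ?Y (harmonic (n - m))"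
  proof (rule approx1_eqI)
    have "even (n - m) = even m" using n(2) m(1) by simp
    then have "(- 1) ^ (n - m) = (- 1 :: rat) ^ m" by (simp add: minus_one_power_iff)
    then show "(- 1) ^ (n - m) * (fact (m + n) * fact (n - m)) * ((- 1) ^ (n - m) * (- 1) ^ m / (fact m * fact (n - m)) ^ 2)
      = (- 1) ^ m * fact (m + n) / (fact m ^ 2 * fact (n - m) :: rat)"
      "fact (p - 1) * ((- 1) ^ (n - m) * (- 1) ^ m / (fact m * fact (n - m)) ^ 2) = (?Y :: rat)"
      using nzf by (simp_all add: divide_simps power2_eq_square)
  qed simp
  from approx1_trans[OF 5 this] have 7: "approx1 R ?Y ?h"
    by (rule approx1_eqI) simp_all
  from TR 7 show ?thesis by (rule approx1_cong_left)
qed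

end

section \<open>The Jacobi sum of a quartic character\<close>

text \<open>By the product formula for sums of two squares,
  \<open>(a * x - b * y) ^ 2 + (a * y + b * x) ^ 2 = p ^ 2\<close>. If the first base is a nonzero
  multiple of \<open>p\<close>, the second vanishes. One of the signs of \<open>b\<close> always
  gives the divisibility.\<close>

lemma sum_two_squares_unique:
  fixes a b x y :: int
  assumes p: "prime p" "odd p" and ab: "p = a ^ 2 + b ^ 2" "odd a" and xy: "p = x ^ 2 + y ^ 2" "odd x"
  shows "a ^ 2 = x ^ 2"
proof -
  have main: "a ^ 2 = x ^ 2" if ab: "p = a ^ 2 + b ^ 2" "odd a" and d: "p dvd a * x - b * y" for a b :: int
  proof -
    have ev: "even y" "even b" using p(2) ab xy by (metis even_add even_power zero_less_numeral)+
    obtain k where k: "a * x - b * y = p * k" using d by blast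
    have "(a * x - b * y) ^ 2 + (a * y + b * x) ^ 2 = (a ^ 2 + b ^ 2) * (x ^ 2 + y ^ 2)"
      by (simp add: power2_eq_square algebra_simps)
    then have sq: "p ^ 2 * k ^ 2 + (a * y + b * x) ^ 2 = p ^ 2"
      using k ab xy by (simp add: power_mult_distrib flip: power2_eq_square)
    \<comment> \<open>Parity decides: \<open>b\<close> and \<open>y\<close> are even while
      \<open>a * x\<close> is odd.\<close>
    have "k \<noteq> 0"
    proof
      assume "k = 0"
      then have "a * x = b * y" using k by simp
      then have "even (a * x)" using ev by simp
      then show False using ab(2) xy(2) by simp
    qed
    then have "1 \<le> k ^ 2" by (simp add: int_one_le_iff_zero_less)
    then have "p ^ 2 * 1 \<le> p ^ 2 * k ^ 2" by (intro mult_left_mono) auto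
    then have "(a * y + b * x) ^ 2 \<le> 0" using sq by linarith
    then have "a * y = - (b * x)" by simp
    then have "a ^ 2 * y ^ 2 = b ^ 2 * x ^ 2" by (metis power_mult_distrib power2_minus)
    moreover have "y ^ 2 = p - x ^ 2" "b ^ 2 = p - a ^ 2" using ab xy by auto
    ultimately have "a ^ 2 * p = x ^ 2 * p" by (simp add: algebra_simps)
    then show ?thesis using p by auto
  qed
  have "(a * x - b * y) * (a * x + b * y) = p * (a ^ 2 + x ^ 2 - p)"
  proof -
    have "(a * x - b * y) * (a * x + b * y) = a ^ 2 * x ^ 2 - b ^ 2 * y ^ 2"
      by (simp add: power2_eq_square algebra_simps)
    also have "b ^ 2 = p - a ^ 2" using ab by simp
    also have "y ^ 2 = p - x ^ 2" using xy by simp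
    finally show ?thesis by (simp add: algebra_simps power2_eq_square)
  qed
  then have "p dvd (a * x - b * y) * (a * x + b * y)" by simp
  then have "p dvd a * x - b * y \<or> p dvd a * x + b * y" using p(1) by (simp add: prime_dvd_mult_iff)
  then show ?thesis
  proof
    assume "p dvd a * x - b * y"
    then show ?thesis using main[of a b] ab by blast
  next
    assume "p dvd a * x + b * y"
    then show ?thesis using main[of a "- b"] ab by simp
  qed
qed

lemma imaginary_power_cong:
  assumes "[j = k] (mod 4)" shows "\<i> ^ j = \<i> ^ k"
proof -
  have "\<i> ^ m = \<i> ^ (m mod 4)" for m
  proof -
    have "\<i> ^ (4 * q + s) = \<i> ^ s" for q s
      by (simp add: power_add power_mult)
    from this[of "m div 4" "m mod 4"] show ?thesis by (simp only: mult_div_mod_eq)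
  qed
  then show ?thesis using assms unfolding cong_def by metis
qed

text \<open>Both factors of \<open>a ^ p - b ^ p = (a - b) * (\<dots>)\<close> are divisible by
  \<open>p\<close>. Thus \<open>t ^ p\<close> modulo \<open>p ^ 2\<close> depends only on
  \<open>t\<close> modulo \<open>p\<close> and serves as its Teichmueller representative.\<close>

lemma (in odd_prime) cong_power_p:
  fixes a b :: int
  assumes "[a = b] (mod int p)"
  shows "[a ^ p = b ^ p] (mod int p ^ 2)"
proof -
  have "[(\<Sum>i<p. b ^ (p - Suc i) * a ^ i) = (\<Sum>i<p. b ^ (p - Suc i) * b ^ i)] (mod int p)"
    using assms by (intro cong_sum cong_mult cong_pow cong_refl)
  also have "(\<Sum>i<p. b ^ (p - Suc i) * b ^ i) = int p * b ^ (p - 1)"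
    by (simp flip: power_add)
  finally have "int p dvd (\<Sum>i<p. b ^ (p - Suc i) * a ^ i)"
    by (simp add: cong_dvd_iff)
  then have "int p * int p dvd (a - b) * (\<Sum>i<p. b ^ (p - Suc i) * a ^ i)"
    using assms by (intro mult_dvd_mono) (auto simp: cong_iff_dvd_diff)
  then show ?thesis
    by (simp add: cong_iff_dvd_diff power_diff_sumr2 power2_eq_square)
qed

section \<open>The character attached to a primitive root\<close>

locale quartic_character = odd_prime +
  fixes r g :: nat
  assumes p_eq: "p = 4 * r + 1" and primroot: "residue_primroot p g"
begin

lemma r_pos: "r > 0"
  using p_eq p_gt_2 by auto

lemma not_dvd_g_power: "\<not> int p dvd int g ^ k"
proof
  assume "int p dvd int g ^ k"
  then have "p dvd g ^ k" by (simp flip: of_nat_power)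
  then have "p dvd g" using prime_p prime_dvd_power by blast
  then show False using primroot prime_p unfolding residue_primroot_def
    by (metis coprime_absorb_left not_prime_unit)
qed

lemma g_power_cong_iff: "[int g ^ j = int g ^ k] (mod int p) \<longleftrightarrow> [j = k] (mod p - 1)"
proof -
  have "[int g ^ j = int g ^ k] (mod int p) \<longleftrightarrow> [g ^ j = g ^ k] (mod p)"
    by (simp flip: of_nat_power cong_int_iff)
  then show ?thesis
    using primroot prime_p by (simp add: residue_primroot_def order_divides_expdiff totient_prime)
qed

lemma exists_index:
  assumes "\<not> int p dvd t" shows "\<exists>k. [t = int g ^ k] (mod int p)"
proof -
  define u where "u = nat (t mod int p)"
  have u: "int u = t mod int p" unfolding u_def by simp
  have "u \<noteq> 0" using assms u by (metis dvd_eq_mod_eq_0 of_nat_0)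
  moreover have "int u < int p" unfolding u by simp
  ultimately have "0 < u" "u < p" by auto
  then have "u \<in> totatives p" using prime_p by (simp add: totatives_prime)
  then obtain k where "g ^ k mod p = u"
    using residue_primroot_is_generator[OF _ primroot] p_gt_2 by (force simp: bij_betw_def)
  then have "int g ^ k mod int p = t mod int p" using u by (metis of_nat_mod of_nat_power)
  then show ?thesis by (metis cong_def)
qed

text \<open>The index picked by \<open>SOME\<close> is determined modulo \<open>p - 1\<close>, a
  multiple of 4, so the value does not depend on the choice.\<close>

definition chi :: "int \<Rightarrow> complex"
  where "chi t = (if int p dvd t then 0 else \<i> ^ (SOME k. [t = int g ^ k] (mod int p)))"

lemma chi_power:
  assumes "[t = int g ^ k] (mod int p)" shows "chi t = \<i> ^ k"
proof -
  define k' where "k' = (SOME k. [t = int g ^ k] (mod int p))"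
  have "[t = int g ^ k'] (mod int p)" unfolding k'_def using assms by (rule someI)
  then have "[int g ^ k' = int g ^ k] (mod int p)" using assms by (metis cong_sym cong_trans)
  then have "[k' = k] (mod 4 * r)" using g_power_cong_iff p_eq by simp
  then have "[k' = k] (mod 4)" by (rule cong_dvd_modulus_nat) simp
  moreover have "\<not> int p dvd t" using assms not_dvd_g_power cong_dvd_iff by blast
  ultimately show ?thesis unfolding chi_def k'_def by (simp add: imaginary_power_cong)
qed

lemma chi_eq_0 [simp]: "int p dvd t \<Longrightarrow> chi t = 0"
  by (simp add: chi_def)

lemma chi_cong: "[s = t] (mod int p) \<Longrightarrow> chi s = chi t"
  by (metis cong_dvd_iff cong_trans chi_eq_0 chi_power exists_index)

lemma chi_mult: "chi (s * t) = chi s * chi t"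
proof (cases "int p dvd s \<or> int p dvd t")
  case False
  then obtain j k where jk: "[s = int g ^ j] (mod int p)" "[t = int g ^ k] (mod int p)"
    using exists_index by blast
  have "[s * t = int g ^ (j + k)] (mod int p)" unfolding power_add using jk by (rule cong_mult)
  from chi_power[OF this] show ?thesis using jk by (simp add: chi_power power_add)
qed auto

lemma chi_cnj: "\<not> int p dvd t \<Longrightarrow> chi t * cnj (chi t) = 1"
  using exists_index[of t] by (auto simp: chi_power simp flip: power_mult_distrib)

lemma chi_1: "chi 1 = 1"
  using chi_power[of 1 0] by simp

text \<open>Affine maps with invertible slope permute the residues modulo \<open>p\<close>. The
  target type is general because both complex and integer summands occur.\<close>

lemma sum_affine:
  fixes f :: "int \<Rightarrow> 'a :: comm_monoid_add"
  assumes f: "\<And>s t. [s = t] (mod int p) \<Longrightarrow> f s = f t" and c: "\<not> int p dvd c"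
  shows "(\<Sum>t\<in>{0..<int p}. f (c * t + d)) = (\<Sum>t\<in>{0..<int p}. f t)"
proof -
  let ?h = "\<lambda>t. (c * t + d) mod int p"
  have "inj_on ?h {0..<int p}"
  proof (rule inj_onI)
    fix s t assume st: "s \<in> {0..<int p}" "t \<in> {0..<int p}" "?h s = ?h t"
    then have "[c * s + d = c * t + d] (mod int p)" by (simp add: cong_def)
    then have "[c * s = c * t] (mod int p)" by (simp add: cong_add_rcancel)
    moreover have "coprime c (int p)"
      using prime_imp_coprime[of "int p" c] c prime_p coprime_commute[of c "int p"] by simp
    ultimately have "[s = t] (mod int p)" by (simp add: cong_mult_lcancel)
    then show "s = t" using st by (simp add: cong_def)
  qed
  moreover have "?h ` {0..<int p} \<subseteq> {0..<int p}" using p_gt_2 by auto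
  ultimately have "bij_betw ?h {0..<int p} {0..<int p}"
    by (simp add: bij_betw_def endo_inj_surj)
  then have "(\<Sum>t\<in>{0..<int p}. f (?h t)) = (\<Sum>t\<in>{0..<int p}. f t)"
    by (rule sum.reindex_bij_betw)
  moreover have "f (?h t) = f (c * t + d)" for t by (rule f) (simp add: cong_def)
  ultimately show ?thesis by simp
qed

text \<open>Substituting \<open>g * t\<close> multiplies the two sums by \<open>\<i>\<close> and
  \<open>- 1\<close>, neither of which is 1.\<close>

lemma sum_chi: "(\<Sum>t\<in>{0..<int p}. chi t) = 0" (is "?S = 0")
  and sum_chi_square: "(\<Sum>t\<in>{0..<int p}. chi t ^ 2) = 0" (is "?S2 = 0")
proof -
  have g: "\<not> p dvd g" using not_dvd_g_power[of 1] by simp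
  have chi_g: "chi (int g) = \<i>" using chi_power[of "int g" 1] by simp
  have "(\<Sum>t\<in>{0..<int p}. chi (int g * t + 0)) = ?S"
    by (rule sum_affine) (use g in \<open>auto intro: chi_cong\<close>)
  then have "\<i> * ?S = 1 * ?S" by (simp add: chi_mult chi_g sum_distrib_left)
  then show "?S = 0" by (subst (asm) mult_cancel_right) (auto simp: complex_eq_iff)
  have "(\<Sum>t\<in>{0..<int p}. chi (int g * t + 0) ^ 2) = ?S2"
    by (rule sum_affine[where f = "\<lambda>t. chi t ^ 2"]) (use g in \<open>auto intro: chi_cong arg_cong[where f = "\<lambda>z. z ^ 2"]\<close>)
  then have "(-1) * ?S2 = 1 * ?S2" by (simp add: chi_mult chi_g power_mult_distrib sum_negf)
  then show "?S2 = 0" by (subst (asm) mult_cancel_right) simp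
qed

lemma sum_chi_cnj: "(\<Sum>q\<in>{0..<int p}. chi q * cnj (chi q)) = of_nat (p - 1)"
proof -
  have "(\<Sum>q\<in>{0..<int p}. chi q * cnj (chi q)) = (\<Sum>q\<in>{0<..<int p}. 1)"
    by (rule sum.mono_neutral_cong_right) (auto intro!: chi_cnj dest: zdvd_imp_le)
  then show ?thesis using p_gt_2 by (simp add: of_nat_diff nat_diff_distrib)
qed

lemma not_dvd_range: "t \<in> {0<..<int p} \<Longrightarrow> \<not> int p dvd t"
  by (auto dest: zdvd_imp_le)

text \<open>Replacing \<open>q\<close> by \<open>d * q\<close> normalises the shift to 1, and
  replacing it by \<open>c * q\<close> in the normalised sum extracts \<open>chi c\<close>.\<close>

lemma chi_correlation:
  assumes "\<not> int p dvd c" "\<not> int p dvd d"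
  shows "(\<Sum>q\<in>{0..<int p}. chi (d + c * q) * cnj (chi q))
    = chi c * (\<Sum>q\<in>{0..<int p}. chi (1 + q) * cnj (chi q))"
proof -
  have per: "chi (e + m * s) * cnj (chi s) = chi (e + m * t) * cnj (chi t)" if "[s = t] (mod int p)" for e m s t
    using that by (metis chi_cong cong_add cong_mult cong_refl)
  have 1: "(\<Sum>q\<in>{0..<int p}. chi (d + c * q) * cnj (chi q)) = (\<Sum>q\<in>{0..<int p}. chi (1 + c * q) * cnj (chi q))"
  proof -
    have "(\<Sum>q\<in>{0..<int p}. chi (d + c * (d * q + 0)) * cnj (chi (d * q + 0)))
      = (\<Sum>q\<in>{0..<int p}. chi (d + c * q) * cnj (chi q))"
      by (rule sum_affine[where f = "\<lambda>q. chi (d + c * q) * cnj (chi q)"]) (use per assms(2) in auto)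
    moreover have "chi (d + c * (d * q + 0)) * cnj (chi (d * q + 0)) = chi (1 + c * q) * cnj (chi q)" for q
    proof -
      have "d + c * (d * q + 0) = d * (1 + c * q)" by (simp add: algebra_simps)
      then have "chi (d + c * (d * q + 0)) * cnj (chi (d * q + 0)) = (chi d * cnj (chi d)) * (chi (1 + c * q) * cnj (chi q))"
        by (simp add: chi_mult)
      then show ?thesis by (simp add: chi_cnj assms(2))
    qed
    ultimately show ?thesis by simp
  qed
  have 2: "(\<Sum>q\<in>{0..<int p}. chi (1 + c * q) * cnj (chi q)) = chi c * (\<Sum>q\<in>{0..<int p}. chi (1 + q) * cnj (chi q))"
  proof -
    have "(\<Sum>q\<in>{0..<int p}. chi (1 + 1 * (c * q + 0)) * cnj (chi (c * q + 0)))
      = (\<Sum>q\<in>{0..<int p}. chi (1 + 1 * q) * cnj (chi q))"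
      by (rule sum_affine[where f = "\<lambda>q. chi (1 + 1 * q) * cnj (chi q)"]) (use per assms(1) in blast)+
    then have "(\<Sum>q\<in>{0..<int p}. chi (1 + q) * cnj (chi q))
      = cnj (chi c) * (\<Sum>q\<in>{0..<int p}. chi (1 + c * q) * cnj (chi q))"
      by (simp add: chi_mult sum_distrib_left mult_ac)
    then have "chi c * (\<Sum>q\<in>{0..<int p}. chi (1 + q) * cnj (chi q))
      = (chi c * cnj (chi c)) * (\<Sum>q\<in>{0..<int p}. chi (1 + c * q) * cnj (chi q))"
      by (simp add: mult.assoc)
    then show ?thesis using chi_cnj[OF assms(1)] by simp
  qed
  show ?thesis using 1 2 by simp
qed

lemma range_split: "{0..<int p} = insert 0 {0<..<int p}"
  using p_gt_2 by auto

text \<open>Summed over all shifts the correlations give 0. Shift 0 contributes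
  \<open>p - 1\<close>, and the other \<open>p - 1\<close> shifts contribute the same value
  each.\<close>

lemma chi_correlation_1: "(\<Sum>q\<in>{0..<int p}. chi (1 + q) * cnj (chi q)) = - 1" (is "?M = - 1")
proof -
  let ?F = "\<lambda>d. \<Sum>q\<in>{0..<int p}. chi (d + q) * cnj (chi q)"
  have "(\<Sum>d\<in>{0..<int p}. ?F d) = (\<Sum>q\<in>{0..<int p}. (\<Sum>d\<in>{0..<int p}. chi (d + q)) * cnj (chi q))"
    by (subst sum.swap) (simp add: sum_distrib_right)
  also have "\<dots> = 0"
  proof -
    have "(\<Sum>d\<in>{0..<int p}. chi (1 * d + q)) = (\<Sum>d\<in>{0..<int p}. chi d)" for q
      using p_gt_2 by (intro sum_affine chi_cong) auto
    then show ?thesis by (simp add: sum_chi)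
  qed
  finally have "?F 0 + (\<Sum>d\<in>{0<..<int p}. ?F d) = 0"
    unfolding range_split by simp
  moreover have "(\<Sum>d\<in>{0<..<int p}. ?F d) = (\<Sum>d\<in>{0<..<int p}. ?M)"
  proof (rule sum.cong)
    fix d assume "d \<in> {0<..<int p}"
    then show "?F d = ?M" using chi_correlation[of 1 d] not_dvd_range[of d] p_gt_2 chi_1 by simp
  qed simp
  moreover have "(\<Sum>d\<in>{0<..<int p}. ?M) = of_nat (p - 1) * ?M"
  proof -
    have "card {0<..<int p} = p - 1" by simp
    then show ?thesis by (simp only: sum_constant)
  qed
  moreover have "?F 0 = of_nat (p - 1)" unfolding add_0 by (rule sum_chi_cnj)
  ultimately have "of_nat (p - 1) * (1 + ?M) = 0"
    by (simp only: distrib_left mult_1_right)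
  moreover have "of_nat (p - 1) \<noteq> (0 :: complex)" using p_gt_2 by (subst of_nat_eq_0_iff) auto
  ultimately show ?thesis by (metis add_eq_0_iff mult_eq_0_iff)
qed

definition jacobi :: complex
  where "jacobi = (\<Sum>t\<in>{0..<int p}. chi t * chi (1 - t))"

text \<open>The substitution \<open>t * c\<close> in one factor of the double sum turns it into
  correlations weighted by \<open>chi c\<close>. Only \<open>c = 1\<close> gives the summand
  \<open>p\<close>; the rest cancels since \<open>chi\<close> and its square sum to 0.\<close>

lemma jacobi_norm: "jacobi * cnj jacobi = of_nat p"
proof -
  let ?I = "{0..<int p}"
  let ?K = "\<lambda>c. \<Sum>t\<in>?I. chi (1 - t * c) * cnj (chi (1 - t))"
  have per: "chi s * chi (1 - s) = chi t * chi (1 - t)" if "[s = t] (mod int p)" for s t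
    using that by (metis chi_cong cong_diff cong_refl)
  have inner: "jacobi * cnj (chi t * chi (1 - t)) = (\<Sum>c\<in>?I. chi c * (chi (1 - t * c) * cnj (chi (1 - t))))"
    if "t \<in> {0<..<int p}" for t
  proof -
    have t: "\<not> int p dvd t" using that by (rule not_dvd_range)
    have "jacobi = (\<Sum>c\<in>?I. chi (t * c + 0) * chi (1 - (t * c + 0)))"
      unfolding jacobi_def
      by (rule sum_affine[where f = "\<lambda>s. chi s * chi (1 - s)", symmetric]) (use per t in auto)
    then have "jacobi * cnj (chi t * chi (1 - t)) = (\<Sum>c\<in>?I. (chi t * cnj (chi t)) * (chi c * (chi (1 - t * c) * cnj (chi (1 - t)))))"
      by (simp add: sum_distrib_left chi_mult mult_ac)
    then show ?thesis using chi_cnj[OF t] by simp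
  qed
  have "jacobi * cnj jacobi = (\<Sum>t\<in>?I. jacobi * cnj (chi t * chi (1 - t)))"
    by (simp add: sum_distrib_left cnj_sum jacobi_def[THEN arg_cong[where f = cnj]])
  also have "\<dots> = (\<Sum>t\<in>{0<..<int p}. jacobi * cnj (chi t * chi (1 - t)))"
    by (rule sum.mono_neutral_right) (auto simp: range_split)
  also have "\<dots> = (\<Sum>t\<in>{0<..<int p}. \<Sum>c\<in>?I. chi c * (chi (1 - t * c) * cnj (chi (1 - t))))"
    by (rule sum.cong[OF refl]) (rule inner)
  also have "\<dots> = (\<Sum>c\<in>?I. chi c * (\<Sum>t\<in>{0<..<int p}. chi (1 - t * c) * cnj (chi (1 - t))))"
    by (subst sum.swap) (simp add: sum_distrib_left)
  \<comment> \<open>Extending the range to \<open>t = 0\<close> adds a term equal to 1, which is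
    subtracted again.\<close>
  also have "\<dots> = (\<Sum>c\<in>?I. chi c * (?K c - 1))"
    by (rule sum.cong) (auto simp: range_split chi_1)
  also have "\<dots> = (\<Sum>c\<in>?I. (if c = 1 then of_nat p else 0) - chi c ^ 2 - chi c)"
  proof (rule sum.cong)
    fix c assume c: "c \<in> ?I"
    have K: "?K c = (\<Sum>q\<in>?I. chi ((1 - c) + c * q) * cnj (chi q))"
    proof -
      have "?K c = (\<Sum>t\<in>?I. chi ((1 - c) + c * (- 1 * t + 1)) * cnj (chi (- 1 * t + 1)))"
        by (rule sum.cong) (auto simp: algebra_simps)
      also have "\<dots> = (\<Sum>q\<in>?I. chi ((1 - c) + c * q) * cnj (chi q))"
      proof (rule sum_affine[where f = "\<lambda>q. chi ((1 - c) + c * q) * cnj (chi q)"])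
        show "chi ((1 - c) + c * s) * cnj (chi s) = chi ((1 - c) + c * t) * cnj (chi t)"
          if "[s = t] (mod int p)" for s t
          using that by (metis chi_cong cong_add cong_mult cong_refl)
      qed (use p_gt_2 in auto)
      finally show ?thesis .
    qed
    consider "c = 0" | "c = 1" | "c \<in> {1<..<int p}" using c by force
    then show "chi c * (?K c - 1) = (if c = 1 then of_nat p else 0) - chi c ^ 2 - chi c"
    proof cases
      case 1 then show ?thesis by simp
    next
      case 2
      then have "?K c = of_nat (p - 1)" unfolding K by (simp add: sum_chi_cnj)
      then show ?thesis using 2 p_gt_2 by (simp add: chi_1 of_nat_diff)
    next
      case 3
      have "\<not> int p dvd c" "\<not> int p dvd c - 1" using 3 not_dvd_range[of c] not_dvd_range[of "c - 1"] by auto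
      then have "\<not> int p dvd 1 - c" by (metis dvd_minus_iff minus_diff_eq)
      from chi_correlation[OF \<open>\<not> int p dvd c\<close> this]
      have "?K c = - chi c" unfolding K chi_correlation_1 by simp
      then show ?thesis using 3 by (simp add: power2_eq_square algebra_simps)
    qed
  qed simp
  also have "\<dots> = of_nat p"
    using p_gt_2 by (simp add: sum_subtractf sum_chi sum_chi_square)
  finally show ?thesis .
qed

section \<open>Reduction of Gaussian integers modulo the square of p\<close>

definition iota :: int
  where "iota = int g ^ (r * p)"

text \<open>\<open>g ^ (2 * r)\<close> squares to 1 modulo \<open>p\<close> but is not 1 because
  \<open>g\<close> is primitive, so it is \<open>- 1\<close>. Taking odd \<open>p\<close>-th powers
  lifts this to modulo \<open>p ^ 2\<close>.\<close>

lemma iota_square: "[iota ^ 2 = - 1] (mod int p ^ 2)"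
proof -
  have "[int g ^ (4 * r) = int g ^ 0] (mod int p)" unfolding g_power_cong_iff by (simp add: p_eq cong_def)
  then have "int p dvd (int g ^ (2 * r)) ^ 2 - 1"
    by (simp add: cong_iff_dvd_diff mult.commute flip: power_mult)
  moreover have "(int g ^ (2 * r)) ^ 2 - 1 = (int g ^ (2 * r) - 1) * (int g ^ (2 * r) + 1)"
    by (simp add: power2_eq_square algebra_simps)
  moreover have "\<not> int p dvd int g ^ (2 * r) - 1"
  proof
    assume "int p dvd int g ^ (2 * r) - 1"
    then have "[int g ^ (2 * r) = int g ^ 0] (mod int p)" by (simp add: cong_iff_dvd_diff)
    then show False unfolding g_power_cong_iff using r_pos by (simp add: p_eq cong_def)
  qed
  ultimately have "int p dvd int g ^ (2 * r) + 1" using prime_p by (simp add: prime_dvd_mult_iff)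
  then have "[int g ^ (2 * r) = - 1] (mod int p)" by (simp add: cong_iff_dvd_diff)
  from cong_power_p[OF this] show ?thesis
    unfolding iota_def using odd_p by (simp add: mult_ac flip: power_mult)
qed

text \<open>The reduction of a Gaussian integer modulo \<open>p\<^sup>2\<close> under the ring homomorphism that sends the
  imaginary unit to \<open>iota\<close>.\<close>

definition reduces_to :: "complex \<Rightarrow> int \<Rightarrow> bool"
  where "reduces_to z m \<longleftrightarrow>
    (\<exists>a b. z = of_int a + \<i> * of_int b \<and> [m = a + b * iota] (mod int p ^ 2))"

lemma reduces_to_cong: "reduces_to z m \<Longrightarrow> [m' = m] (mod int p ^ 2) \<Longrightarrow> reduces_to z m'"
  unfolding reduces_to_def using cong_trans by blast

lemma reduces_to_int: "reduces_to (of_int a) a"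
  unfolding reduces_to_def by (intro exI[of _ a] exI[of _ 0]) simp

lemma reduces_to_imaginary: "reduces_to \<i> iota"
  unfolding reduces_to_def by (intro exI[of _ 0] exI[of _ 1]) simp

lemma reduces_to_add: assumes "reduces_to z m" "reduces_to w n" shows "reduces_to (z + w) (m + n)"
proof -
  obtain a b c d where *: "z = of_int a + \<i> * of_int b" "[m = a + b * iota] (mod int p ^ 2)"
    "w = of_int c + \<i> * of_int d" "[n = c + d * iota] (mod int p ^ 2)"
    using assms unfolding reduces_to_def by blast
  have "[m + n = (a + b * iota) + (c + d * iota)] (mod int p ^ 2)" using * by (intro cong_add)
  then show ?thesis unfolding reduces_to_def using *
    by (intro exI[of _ "a + c"] exI[of _ "b + d"]) (simp add: algebra_simps)
qed

lemma reduces_to_mult: assumes "reduces_to z m" "reduces_to w n" shows "reduces_to (z * w) (m * n)"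
proof -
  obtain a b c d where *: "z = of_int a + \<i> * of_int b" "[m = a + b * iota] (mod int p ^ 2)"
    "w = of_int c + \<i> * of_int d" "[n = c + d * iota] (mod int p ^ 2)"
    using assms unfolding reduces_to_def by blast
  have "[m * n = (a + b * iota) * (c + d * iota)] (mod int p ^ 2)" using * by (intro cong_mult)
  also have "(a + b * iota) * (c + d * iota) = a * c + (a * d + b * c) * iota + b * d * iota ^ 2"
    by (simp add: power2_eq_square algebra_simps)
  also have "[\<dots> = a * c + (a * d + b * c) * iota + b * d * (- 1)] (mod int p ^ 2)"
    by (intro cong_add cong_mult cong_refl iota_square)
  finally show ?thesis unfolding reduces_to_def using *
    by (intro exI[of _ "a * c - b * d"] exI[of _ "a * d + b * c"]) (simp add: algebra_simps)
qed

lemma reduces_to_power: "reduces_to z m \<Longrightarrow> reduces_to (z ^ k) (m ^ k)"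
  using reduces_to_int[of 1] by (induction k) (auto intro: reduces_to_mult)

lemma reduces_to_sum: "(\<And>i. i \<in> I \<Longrightarrow> reduces_to (f i) (h i)) \<Longrightarrow> reduces_to (sum f I) (sum h I)"
  using reduces_to_int[of 0] by (induction I rule: infinite_finite_induct) (auto intro: reduces_to_add)

text \<open>For \<open>t\<close> congruent to \<open>g ^ k\<close>, the conjugate value is the
  \<open>3 * k\<close>-th power of \<open>\<i>\<close>, while \<open>t ^ (3 * r * p)\<close> is that
  power of \<open>iota\<close>. The conjugate is used because its Jacobi sum is the one that reduces
  to a unit.\<close>

lemma cnj_chi_reduces_to: "reduces_to (cnj (chi t)) (t ^ (3 * r * p))"
proof (cases "int p dvd t")
  case True
  then have "int p ^ 2 dvd t ^ 2" by (rule dvd_power_same)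
  also have "t ^ 2 dvd t ^ (3 * r * p)" using r_pos p_gt_2 mult_le_mono[of 1 "3 * r" 2 p] by (intro le_imp_power_dvd) simp
  finally have "[t ^ (3 * r * p) = 0] (mod int p ^ 2)" by (simp add: cong_0_iff)
  then show ?thesis using True reduces_to_cong[OF reduces_to_int[of 0]] by simp
next
  case False
  then obtain k where k: "[t = int g ^ k] (mod int p)" using exists_index by blast
  have "cnj \<i> = \<i> ^ 3" by (simp add: eval_nat_numeral)
  then have "cnj (chi t) = (\<i> ^ 3) ^ k" by (simp add: chi_power[OF k])
  moreover have "[t ^ (3 * r * p) = (iota ^ 3) ^ k] (mod int p ^ 2)"
    using cong_pow[OF cong_power_p[OF k], of "3 * r"] unfolding iota_def
    by (simp add: mult_ac flip: power_mult)
  moreover have "reduces_to ((\<i> ^ 3) ^ k) ((iota ^ 3) ^ k)"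
    by (intro reduces_to_power reduces_to_imaginary)
  ultimately show ?thesis using reduces_to_cong by simp
qed

lemma cnj_jacobi_reduces_to:
  "reduces_to (cnj jacobi) (\<Sum>t\<in>{0..<int p}. t ^ (3 * r * p) * (1 - t) ^ (3 * r * p))"
  unfolding jacobi_def cnj_sum complex_cnj_mult
  by (intro reduces_to_sum reduces_to_mult cnj_chi_reduces_to)

text \<open>The involution \<open>1 - t\<close> pairs equal terms, so the sum is twice a Gaussian
  integer plus the term at the fixed point \<open>(p + 1) div 2\<close>, which is a square of a
  character value and equals 1 or \<open>- 1\<close>.\<close>

lemma jacobi_real_part_odd:
  assumes "jacobi = of_int a + \<i> * of_int b" shows "odd a"
proof -
  define R where "R = int r"
  have R: "R > 0" "int p = 4 * R + 1" using r_pos p_eq by (auto simp: R_def)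
  let ?f = "\<lambda>t. chi t * chi (1 - t)"
  let ?S = "\<Sum>t\<in>{1..2 * R}. ?f t"
  have sym: "?f (4 * R + 2 - t) = ?f t" for t
  proof -
    have "chi (4 * R + 2 - t) = chi (1 - t)" "chi (1 - (4 * R + 2 - t)) = chi t"
    proof -
      have "4 * R + 2 - t - (1 - t) = int p * 1" "1 - (4 * R + 2 - t) - t = int p * (- 1)" using R(2) by auto
      then show "chi (4 * R + 2 - t) = chi (1 - t)" "chi (1 - (4 * R + 2 - t)) = chi t"
        by (metis cong_iff_dvd_diff chi_cong dvd_triv_left)+
    qed
    then show ?thesis by simp
  qed
  have "{0..<int p} = insert 0 ({1..2 * R} \<union> {2 * R + 1} \<union> {2 * R + 2..4 * R})" using R by auto
  then have "jacobi = (\<Sum>t\<in>insert 0 ({1..2 * R} \<union> {2 * R + 1} \<union> {2 * R + 2..4 * R}). ?f t)"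
    unfolding jacobi_def by simp
  also have "\<dots> = ?f 0 + (?S + ?f (2 * R + 1) + (\<Sum>t\<in>{2 * R + 2..4 * R}. ?f t))"
  proof -
    have "sum ?f ({1..2 * R} \<union> {2 * R + 1} \<union> {2 * R + 2..4 * R})
        = sum ?f ({1..2 * R} \<union> {2 * R + 1}) + sum ?f {2 * R + 2..4 * R}"
      by (rule sum.union_disjoint) auto
    also have "sum ?f ({1..2 * R} \<union> {2 * R + 1}) = ?S + sum ?f {2 * R + 1}"
      by (rule sum.union_disjoint) auto
    finally show ?thesis using R by (subst sum.insert) auto
  qed
  \<comment> \<open>\<open>4 * R + 2 - t\<close> is \<open>1 - t\<close> modulo \<open>p\<close>.
    The image omits \<open>t = 1\<close>, where the term is 0.\<close>
  also have "(\<Sum>t\<in>{2 * R + 2..4 * R}. ?f t) = (\<Sum>t\<in>{2..2 * R}. ?f t)"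
    by (rule sum.reindex_bij_witness[of _ "\<lambda>t. 4 * R + 2 - t" "\<lambda>t. 4 * R + 2 - t"])
      (auto simp: sym[simplified])
  also have "(\<Sum>t\<in>{2..2 * R}. ?f t) = ?S"
  proof -
    have "{1..2 * R} = insert 1 {2..2 * R}" using R by auto
    then show ?thesis by simp
  qed
  also have "?f 0 = 0" by simp
  also have "?f (2 * R + 1) = chi (2 * R + 1) ^ 2"
  proof -
    have "1 - (2 * R + 1) - (2 * R + 1) = int p * (- 1)" using R(2) by auto
    then have "chi (1 - (2 * R + 1)) = chi (2 * R + 1)"
      by (metis cong_iff_dvd_diff chi_cong dvd_triv_left)
    then show ?thesis by (simp add: power2_eq_square)
  qed
  finally have J: "jacobi = 2 * ?S + chi (2 * R + 1) ^ 2" by simp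
  have "\<not> int p dvd 2 * R + 1" using R by (auto dest: zdvd_imp_le)
  then obtain k where "[2 * R + 1 = int g ^ k] (mod int p)" using exists_index by blast
  then have c: "chi (2 * R + 1) ^ 2 = (- 1) ^ k" by (simp add: chi_power power_mult[symmetric] mult.commute[of k] power_mult)
  \<comment> \<open>The value of the reduction is irrelevant; its existence shows that
    \<open>?S\<close> is a Gaussian integer.\<close>
  have "\<exists>m. reduces_to ?S m"
  proof -
    have "\<exists>m. reduces_to (chi t) m" for t
      using reduces_to_power[OF reduces_to_imaginary] reduces_to_int[of 0] exists_index chi_power
      by (metis chi_eq_0 of_int_0)
    then obtain h where "\<And>t. reduces_to (chi t) (h t)" by metis
    then show ?thesis using reduces_to_sum reduces_to_mult by meson
  qed
  then obtain a' b' where "?S = of_int a' + \<i> * of_int b'" unfolding reduces_to_def by blast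
  then have "of_int a + \<i> * of_int b = 2 * (of_int a' + \<i> * of_int b') + (of_int ((- 1) ^ k) :: complex)"
    using J c assms by simp
  then have "Re (of_int a + \<i> * of_int b) = Re (2 * (of_int a' + \<i> * of_int b') + of_int ((- 1) ^ k))"
    by (rule arg_cong)
  then have "real_of_int a = of_int (2 * a' + (- 1) ^ k)" by simp
  then have "a = 2 * a' + (- 1) ^ k" by linarith
  then show ?thesis by simp
qed

text \<open>\<open>U\<close> is the reduction of the conjugate Jacobi sum and \<open>V\<close> that
  of the Jacobi sum. The norm gives \<open>U * V\<close> congruent to \<open>p\<close>, so
  \<open>p\<close> divides \<open>V\<close> and \<open>V ^ 2\<close> drops out of
  \<open>U ^ 2 + V ^ 2\<close>, which is congruent to \<open>2 * a ^ 2 - 2 * b ^ 2\<close>.\<close>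

lemma jacobi_sum_square_cong:
  fixes x y :: int
  defines "U \<equiv> \<Sum>t\<in>{0..<int p}. t ^ (3 * r * p) * (1 - t) ^ (3 * r * p)"
  assumes U: "\<not> int p dvd U" and xy: "int p = x ^ 2 + y ^ 2" "odd x"
  shows "[U ^ 2 = 4 * x ^ 2 - 2 * int p] (mod int p ^ 2)"
proof -
  obtain a b where ab: "cnj jacobi = of_int a + \<i> * of_int b" "[U = a + b * iota] (mod int p ^ 2)"
    using cnj_jacobi_reduces_to unfolding U_def reduces_to_def by blast
  from ab(1) have J: "jacobi = of_int a + \<i> * of_int (- b)"
    by (metis complex_cnj_add complex_cnj_cnj complex_cnj_i complex_cnj_mult complex_cnj_of_int
        minus_mult_minus mult_minus_left mult_minus_right of_int_minus)
  have "of_nat p = (of_int a + \<i> * of_int (- b)) * (of_int a + \<i> * of_int b)"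
    using jacobi_norm ab(1) J by simp
  also have "\<dots> = of_int (a ^ 2 + b ^ 2)"
    by (simp add: complex_eq_iff power2_eq_square)
  finally have "of_int (int p) = (of_int (a ^ 2 + b ^ 2) :: complex)" by simp
  then have norm: "int p = a ^ 2 + b ^ 2" by (simp only: of_int_eq_iff)
  have "odd a" using jacobi_real_part_odd[OF J] .
  have a2: "a ^ 2 = x ^ 2"
    by (rule sum_two_squares_unique[OF _ _ norm \<open>odd a\<close> xy]) (use prime_p odd_p in auto)
  define V where "V = a - b * iota"
  have iota: "[- (iota ^ 2) = 1] (mod int p ^ 2)" using cong_minus_minus_iff[of "iota ^ 2" "-1"] iota_square by simp
  have "[U * V = (a + b * iota) * V] (mod int p ^ 2)" using ab by (intro cong_mult) auto
  also have "(a + b * iota) * V = a ^ 2 + b ^ 2 * (- (iota ^ 2))"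
    unfolding V_def by (simp add: power2_eq_square algebra_simps)
  also have "[\<dots> = a ^ 2 + b ^ 2 * 1] (mod int p ^ 2)" by (intro cong_add cong_mult iota cong_refl)
  finally have "[U * V = int p] (mod int p ^ 2)" using norm by simp
  then have "[U * V = int p] (mod int p)" by (rule cong_dvd_modulus) simp
  then have "int p dvd U * V" by (simp add: cong_dvd_iff)
  then have "int p dvd V" using U prime_p by (simp add: prime_dvd_mult_iff)
  then have V2: "[V ^ 2 = 0] (mod int p ^ 2)" by (simp add: cong_0_iff dvd_power_same)
  have "[U ^ 2 + 0 = (a + b * iota) ^ 2 + V ^ 2] (mod int p ^ 2)"
    using ab(2) V2 by (intro cong_add cong_pow) (auto intro: cong_sym)
  also have "(a + b * iota) ^ 2 + V ^ 2 = 2 * a ^ 2 - 2 * b ^ 2 * (- (iota ^ 2))"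
    unfolding V_def by (simp add: power2_eq_square algebra_simps)
  also have "[\<dots> = 2 * a ^ 2 - 2 * b ^ 2 * 1] (mod int p ^ 2)" by (intro cong_diff cong_mult iota cong_refl)
  also have "2 * a ^ 2 - 2 * b ^ 2 * 1 = 4 * x ^ 2 - 2 * int p" using norm a2 by simp
  finally show ?thesis by simp
qed

end

section \<open>The unit root modulo the square of a prime\<close>

text \<open>Absorbing the denominator replaces row \<open>N\<close> by row \<open>Suc N\<close>,
  whose alternating sum is 0; the missing top term gives the right side.\<close>

lemma alternating_binomial_sum_last:
  "(\<Sum>j<Suc N. (- 1) ^ (N - j) * of_nat (N choose j) / of_nat (Suc N - j)) = 1 / (of_nat (Suc N) :: rat)"
proof -
  have term_eq: "(- 1) ^ (N - j) * of_nat (N choose j) / of_nat (Suc N - j)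
      = (- 1) ^ (N - j) * of_nat (Suc N choose j) / (of_nat (Suc N) :: rat)" if "j < Suc N" for j
  proof -
    have "(Suc N - j) * (Suc N choose j) = Suc N * (N choose j)"
      using binomial_absorb_comp[of "Suc N" j] by simp
    then have "of_nat (Suc N - j) * (of_nat (Suc N choose j) :: rat) = of_nat (Suc N) * of_nat (N choose j)"
      by (metis of_nat_mult)
    moreover have "of_nat (Suc N - j) \<noteq> (0 :: rat)" using that by (subst of_nat_eq_0_iff) auto
    moreover have "of_nat (Suc N) \<noteq> (0 :: rat)" by (rule of_nat_neq_0)
    moreover have "a / b = c / d" if "b * c = d * a" "b \<noteq> 0" "d \<noteq> 0" for a b c d :: rat
      using that by (simp add: frac_eq_eq mult.commute)
    ultimately have "of_nat (N choose j) / of_nat (Suc N - j) = of_nat (Suc N choose j) / (of_nat (Suc N) :: rat)"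
      by blast
    then show ?thesis by (simp only: times_divide_eq_right[symmetric])
  qed
  have "(\<Sum>j<Suc N. (- 1) ^ (N - j) * (of_nat (Suc N choose j) :: rat)) = 1"
  proof -
    have "(\<Sum>j\<le>Suc N. (of_nat (Suc N choose j) :: rat) * 1 ^ j * (- 1) ^ (Suc N - j)) = (1 + (- 1)) ^ Suc N"
      by (rule binomial_ring[symmetric])
    then have "(\<Sum>j<Suc N. (of_nat (Suc N choose j) :: rat) * (- 1) ^ (Suc N - j)) + 1 = 0"
      by (simp add: lessThan_Suc_atMost[symmetric] del: sum.lessThan_Suc) simp
    moreover have "(of_nat (Suc N choose j) :: rat) * (- 1) ^ (Suc N - j) = - ((- 1) ^ (N - j) * of_nat (Suc N choose j))"
      if "j < Suc N" for j using that by (simp add: Suc_diff_le)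
    ultimately show ?thesis by (simp add: sum_negf del: sum.lessThan_Suc binomial_Suc_Suc)
  qed
  moreover have "(\<Sum>j<Suc N. (- 1) ^ (N - j) * of_nat (N choose j) / of_nat (Suc N - j))
    = (\<Sum>j<Suc N. (- 1) ^ (N - j) * (of_nat (Suc N choose j) :: rat)) / of_nat (Suc N)"
    unfolding sum_divide_distrib by (rule sum.cong[OF refl]) (simp only: term_eq lessThan_iff)
  ultimately show ?thesis by (simp only:)
qed

text \<open>Both sides are the coefficient of \<open>x ^ m\<close> in
  \<open>(1 + x) ^ N * ln (1 + x)\<close>: the left as a Cauchy product, the right as the derivative
  of the generalized binomial coefficient in its upper argument. The induction uses Pascal's
  rule.\<close>

lemma alternating_binomial_harmonic:
  assumes "m \<le> N"
  shows "(\<Sum>j<m. (- 1) ^ (m - Suc j) * of_nat (N choose j) / of_nat (m - j))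
    = of_nat (N choose m) * (harmonic N - harmonic (N - m))"
  using assms
proof (induction N arbitrary: m)
  case 0
  then show ?case by simp
next
  case (Suc N)
  let ?f = "\<lambda>N m. \<Sum>j<m. (- 1) ^ (m - Suc j) * of_nat (N choose j) / (of_nat (m - j) :: rat)"
  show ?case
  proof (cases m)
    case 0
    then show ?thesis by simp
  next
    case (Suc l)
    have rec: "?f (Suc N) (Suc l) = ?f N (Suc l) + ?f N l"
    proof -
      have "?f (Suc N) (Suc l) = (- 1) ^ l / of_nat (Suc l) +
          (\<Sum>j<l. (- 1) ^ (l - Suc j) * of_nat (Suc N choose Suc j) / of_nat (l - j))"
        by (subst sum.lessThan_Suc_shift) simp
      also have "(\<Sum>j<l. (- 1) ^ (l - Suc j) * of_nat (Suc N choose Suc j) / (of_nat (l - j) :: rat))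
        = ?f N l + (\<Sum>j<l. (- 1) ^ (l - Suc j) * of_nat (N choose Suc j) / of_nat (l - j))"
        by (simp add: algebra_simps add_divide_distrib sum.distrib)
      also have "?f N (Suc l) = (- 1) ^ l / of_nat (Suc l) +
          (\<Sum>j<l. (- 1) ^ (l - Suc j) * of_nat (N choose Suc j) / of_nat (l - j))"
        by (subst sum.lessThan_Suc_shift) simp
      ultimately show ?thesis by simp
    qed
    have l: "l \<le> N" using Suc Suc.prems by simp
    show ?thesis
    proof (cases "l = N")
      case True
      \<comment> \<open>For \<open>l = N\<close> the induction hypothesis does not reach
        \<open>Suc l\<close>, and the preceding lemma fills the gap.\<close>
      have "?f N (Suc N) = 1 / of_nat (Suc N)"
        using alternating_binomial_sum_last[of N] by (simp del: sum.lessThan_Suc of_nat_Suc)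
      then show ?thesis using rec Suc.IH[of N] True Suc
        by (simp add: harmonic_Suc del: sum.lessThan_Suc)
    next
      case False
      then obtain d where d: "N = Suc (l + d)" using l less_iff_Suc_add[of l N] by auto
      have e: "N - l = Suc d" "N - Suc l = d" "Suc N - Suc l = Suc d" using d by auto
      have nz: "of_nat (Suc d) \<noteq> (0 :: rat)" "of_nat (Suc N) \<noteq> (0 :: rat)" by (rule of_nat_neq_0)+
      have "(Suc N - Suc l) * (Suc N choose Suc l) = Suc N * (N choose Suc l)"
        using binomial_absorb_comp[of "Suc N" "Suc l"] by simp
      then have "of_nat (Suc d) * (of_nat (Suc N choose Suc l) :: rat) = of_nat (Suc N) * of_nat (N choose Suc l)"
        unfolding e by (metis of_nat_mult)
      then have A: "of_nat (N choose Suc l) / of_nat (Suc d) = (of_nat (Suc N choose Suc l) :: rat) / of_nat (Suc N)"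
        using nz by (simp add: frac_eq_eq mult.commute del: of_nat_Suc binomial_Suc_Suc)
      have B: "(of_nat (Suc N choose Suc l) :: rat) = of_nat (N choose l) + of_nat (N choose Suc l)" by simp
      have "Suc l \<le> N" using False l by simp
      then have "?f (Suc N) (Suc l) = of_nat (N choose Suc l) * (harmonic N - harmonic d)
          + of_nat (N choose l) * (harmonic N - harmonic (Suc d))"
        unfolding rec using Suc.IH[of "Suc l"] Suc.IH[of l] l e by (simp only:)
      also have "\<dots> = of_nat (Suc N choose Suc l) * (harmonic N - harmonic (Suc d)) + of_nat (N choose Suc l) / of_nat (Suc d)"
        unfolding B harmonic_Suc[of d] by (simp add: algebra_simps del: of_nat_Suc)
      also have "\<dots> = of_nat (Suc N choose Suc l) * (harmonic (Suc N) - harmonic (Suc d))"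
        unfolding A harmonic_Suc[of N] by (simp add: algebra_simps del: of_nat_Suc binomial_Suc_Suc)
      finally show ?thesis unfolding Suc e .
    qed
  qed
qed

lemma binomial_Suc_right:
  "(of_nat (N choose Suc k) :: rat) * of_nat (Suc k) = of_nat (N choose k) * (of_nat N - of_nat k)"
proof (cases "k \<le> N")
  case True
  have "Suc k * (N choose Suc k) = (N - k) * (N choose k)"
    using binomial_absorb_comp[of N k] binomial_absorption[of k N] by simp
  then have "(of_nat (Suc k) :: rat) * of_nat (N choose Suc k) = of_nat (N - k) * of_nat (N choose k)"
    by (metis of_nat_mult)
  then show ?thesis using True by (simp add: of_nat_diff mult.commute)
qed (simp add: binomial_eq_0)

section \<open>Binomial coefficients with upper argument divisible by p\<close>

context odd_prime
begin

text \<open>This is the product of the positive integers up to \<open>p * m\<close> that are prime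
  to \<open>p\<close>, in blocks between multiples of \<open>p\<close>.\<close>

definition unit_part :: "nat \<Rightarrow> rat"
  where "unit_part m = (\<Prod>c<m. \<Prod>i\<in>{0<..p - 1}. 1 * of_nat i + of_nat c * P)"

text \<open>Block \<open>c\<close> has the exponent \<open>c * harmonic (p - 1)\<close>, which
  vanishes modulo \<open>p\<close>.\<close>

lemma approx1_unit_part: "approx1 (unit_part m) (fact (p - 1) ^ m) 0"
proof -
  have "approx1 (\<Prod>i\<in>{0<..p - 1}. 1 * of_nat i + of_nat c * P) (fact (p - 1)) 0" for c
  proof -
    have "p - 1 < p" using p_gt_2 by simp
    from approx1_prod_interval[OF unit_1 Zp_of_nat[of c] le0 this]
    have "approx1 (\<Prod>i\<in>{0<..p - 1}. 1 * of_nat i + of_nat c * P) (fact (p - 1)) (of_nat c * harmonic (p - 1))"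
      by simp
    then show ?thesis
      by (rule approx1_cong) (use Zp_cong_mult[OF Zp_cong_refl[OF Zp_of_nat[of c]] harmonic_p_minus_1] in simp)
  qed
  then have "approx1 (unit_part m) (\<Prod>c<m. fact (p - 1)) (\<Sum>c<m. 0)"
    unfolding unit_part_def by (intro approx1_prod)
  then show ?thesis by simp
qed

lemma fact_mult_p: "fact (p * m) = P ^ m * fact m * unit_part m"
proof (induction m)
  case 0
  then show ?case by (simp add: unit_part_def)
next
  case (Suc m)
  have "fact (p * m + k) = fact (p * m) * (\<Prod>i\<in>{0<..k}. 1 * of_nat i + of_nat m * P)" for k
    by (induction k) (simp_all add: greaterThanAtMost_Suc algebra_simps)
  note step = this[of "p - 1"]
  have "p * Suc m = Suc (p * m + (p - 1))" using p_gt_2 by simp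
  then have "fact (p * Suc m) = of_nat (p * Suc m) * (fact (p * m + (p - 1)) :: rat)"
    by (metis fact_Suc)
  also have "\<dots> = P * of_nat (Suc m) * (fact (p * m) * (\<Prod>i\<in>{0<..p - 1}. 1 * of_nat i + of_nat m * P))"
    unfolding step by (simp only: of_nat_mult)
  also have "\<dots> = P ^ Suc m * fact (Suc m) * unit_part (Suc m)"
    unfolding Suc.IH by (simp add: unit_part_def mult_ac del: of_nat_Suc)
  finally show ?case .
qed

text \<open>In the quotient of factorials the powers of \<open>p\<close> cancel exactly and the unit
  parts cancel modulo \<open>p ^ 2\<close>.\<close>

lemma binomial_mult_p_cong:
  assumes "j \<le> m"
  shows "Zp_cong p (P ^ 2) (of_nat (p * m choose (p * j))) (of_nat (m choose j))"
proof -
  note u = approx1_unit_part[of j] approx1_unit_part[of "m - j"] approx1_unit_part[of m]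
  have nz: "unit_part j \<noteq> 0" "unit_part (m - j) \<noteq> 0"
    using u unfolding approx1_def by (auto dest: Zp_unitD(1))
  have "approx1 (unit_part m / (unit_part j * unit_part (m - j)))
     (fact (p - 1) ^ m / (fact (p - 1) ^ j * fact (p - 1) ^ (m - j))) (0 - (0 + 0))"
    by (intro approx1_div approx1_mult u)
  then have "approx1 (unit_part m / (unit_part j * unit_part (m - j))) 1 0"
    using assms by (simp flip: power_add)
  then have 1: "Zp_cong p (P ^ 2) (unit_part m / (unit_part j * unit_part (m - j))) 1"
    unfolding approx1_def by simp
  have "p * m - p * j = p * (m - j)" "p * j \<le> p * m" using assms by (auto simp: diff_mult_distrib2)
  then have "of_nat (p * m choose (p * j)) = (fact (p * m) / (fact (p * j) * fact (p * (m - j))) :: rat)"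
    by (simp add: binomial_fact)
  also have "\<dots> = (fact m / (fact j * fact (m - j))) * (P ^ m / (P ^ j * P ^ (m - j)))
      * (unit_part m / (unit_part j * unit_part (m - j)))"
    unfolding fact_mult_p by (simp only: times_divide_times_eq mult_ac)
  also have "P ^ m / (P ^ j * P ^ (m - j)) = 1" using assms by (simp flip: power_add)
  also have "fact m / (fact j * fact (m - j)) = (of_nat (m choose j) :: rat)"
    using assms by (simp add: binomial_fact)
  finally show ?thesis using Zp_cong_mult[OF Zp_cong_refl 1, of "of_nat (m choose j)"] by simp
qed

text \<open>The step from \<open>p * j\<close> to \<open>p * j + 1\<close> produces the factor
  \<open>p * (m - j)\<close>. After it, ratios of neighbours matter only modulo \<open>p\<close>,
  where they are \<open>- (i + 1) / (i + 2)\<close>.\<close>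

lemma binomial_mult_p_add_cong:
  assumes "j \<le> m" "Suc i < p"
  shows "Zp_cong p (P ^ 2) (of_nat (p * m choose (p * j + Suc i)))
    (P * (of_nat (m choose j) * (of_nat m - of_nat j) * ((- 1) ^ i / of_nat (Suc i))))"
  using assms(2)
proof (induction i)
  case 0
  define k where "k = p * j"
  have uk: "Zp_unit (of_nat (Suc k))" unfolding k_def
    using unit_of_nat[of "Suc (p * j)"] p_gt_2 by (metis One_nat_def dvd_add_right_iff dvd_triv_left
        nat_dvd_1_iff_1 not_less_iff_gr_or_eq one_less_numeral_iff plus_1_eq_Suc add.commute prime_nat_iff prime_p)
  have eq: "of_nat (p * m choose Suc k) = P * (of_nat (p * m choose k) * (of_nat m - of_nat j) / of_nat (Suc k))"
  proof -
    have "of_nat (p * m choose Suc k) * of_nat (Suc k) = of_nat (p * m choose k) * (P * (of_nat m - of_nat j))"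
      unfolding binomial_Suc_right by (simp add: k_def right_diff_distrib)
    then show ?thesis using Zp_unitD(1)[OF uk] by (simp add: field_simps del: of_nat_Suc)
  qed
  have "Zp_cong p P (of_nat (p * m choose k)) (of_nat (m choose j))"
    using binomial_mult_p_cong[OF assms(1)] unfolding k_def Zp_cong_def power2_eq_square
    by (metis Zp_mult Zp_of_nat mult.assoc)
  moreover have "Zp_cong p P (1 / of_nat (Suc k)) 1"
  proof (rule Zp_cong_I)
    show "1 / of_nat (Suc k) - 1 = P * (- of_nat j / of_nat (Suc k))"
      using Zp_unitD(1)[OF uk] by (simp add: field_simps k_def)
  qed (use uk in \<open>simp_all del: of_nat_Suc\<close>)
  ultimately have "Zp_cong p P (of_nat (p * m choose k) * (of_nat m - of_nat j) * (1 / of_nat (Suc k)))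
      (of_nat (m choose j) * (of_nat m - of_nat j) * 1)"
    by (intro Zp_cong_mult Zp_cong_refl) auto
  from Zp_cong_mult_P[OF this] show ?case unfolding k_def[symmetric] add_Suc_right Nat.add_0_right eq by simp
next
  case (Suc i)
  define k where "k = p * j + Suc i"
  define A where "A = of_nat (m choose j) * (of_nat m - of_nat j :: rat)"
  define u where "u = of_nat m - (of_nat j :: rat)"
  have ui: "Zp_unit (of_nat (Suc i))" "Zp_unit (of_nat (Suc (Suc i)))"
    using Suc.prems by (auto intro!: unit_of_nat_less simp del: of_nat_Suc)
  have "\<not> p dvd Suc (Suc i)" using Suc.prems nat_dvd_not_less by blast
  then have "\<not> p dvd Suc k" unfolding k_def by (metis add_Suc_right dvd_add_right_iff dvd_triv_left)
  then have uk: "Zp_unit (of_nat (Suc k))" by (rule unit_of_nat)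
  have Pk: "of_nat (Suc k) = P * of_nat j + of_nat (Suc (Suc i))" by (simp add: k_def)
  have eq: "of_nat (p * m choose Suc k) = of_nat (p * m choose k) * ((P * u - of_nat (Suc i)) / of_nat (Suc k))"
  proof -
    have "of_nat (p * m choose Suc k) * of_nat (Suc k) = of_nat (p * m choose k) * (P * u - of_nat (Suc i))"
      unfolding binomial_Suc_right by (simp add: k_def u_def algebra_simps)
    then show ?thesis using Zp_unitD(1)[OF uk] by (simp add: field_simps del: of_nat_Suc)
  qed
  have uZ: "u \<in> Zp p" unfolding u_def by simp
  have frac: "Zp_cong p P ((P * u - of_nat (Suc i)) / of_nat (Suc k)) (- of_nat (Suc i) / of_nat (Suc (Suc i)))"
  proof (rule Zp_cong_I)
    define a b c where "a = (of_nat (Suc i) :: rat)" and "b = (of_nat (Suc (Suc i)) :: rat)" and "c = (of_nat (Suc k) :: rat)"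
    have nz: "b \<noteq> 0" "c \<noteq> 0" unfolding b_def c_def by (rule of_nat_neq_0)+
    have c: "c = P * of_nat j + b" unfolding c_def b_def by (rule Pk)
    have "(P * u - a) * b + a * c = P * (u * b + a * of_nat j)" unfolding c by (simp add: algebra_simps)
    then show "(P * u - of_nat (Suc i)) / of_nat (Suc k) - - of_nat (Suc i) / of_nat (Suc (Suc i))
      = P * ((u * of_nat (Suc (Suc i)) + of_nat (Suc i) * of_nat j) / (of_nat (Suc k) * of_nat (Suc (Suc i))))"
      unfolding a_def[symmetric] b_def[symmetric] c_def[symmetric] using nz
      by (simp add: field_simps)
  qed (use uk ui uZ in \<open>simp_all del: of_nat_Suc\<close>)
  have "Zp_cong p (P ^ 2) (of_nat (p * m choose k) * ((P * u - of_nat (Suc i)) / of_nat (Suc k)))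
     (P * (A * ((- 1) ^ i / of_nat (Suc i))) * ((P * u - of_nat (Suc i)) / of_nat (Suc k)))"
    using Suc uk uZ unfolding A_def k_def by (intro Zp_cong_mult[OF _ Zp_cong_refl]) (simp_all del: of_nat_Suc)
  also have "P * (A * ((- 1) ^ i / of_nat (Suc i))) * ((P * u - of_nat (Suc i)) / of_nat (Suc k))
     = P * (A * ((- 1) ^ i / of_nat (Suc i)) * ((P * u - of_nat (Suc i)) / of_nat (Suc k)))"
    by (simp only: mult.assoc)
  also have "Zp_cong p (P ^ 2) \<dots> (P * (A * ((- 1) ^ i / of_nat (Suc i)) * (- of_nat (Suc i) / of_nat (Suc (Suc i)))))"
    using ui by (intro Zp_cong_mult_P Zp_cong_mult[OF Zp_cong_refl frac]) (auto simp: A_def simp del: of_nat_Suc)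
  also have "P * (A * ((- 1) ^ i / of_nat (Suc i)) * (- of_nat (Suc i) / of_nat (Suc (Suc i))))
      = P * (A * ((- 1) ^ Suc i / of_nat (Suc (Suc i))))"
    using Zp_unitD(1)[OF ui(1)] by (simp del: of_nat_Suc)
  finally show ?case unfolding eq[symmetric] unfolding k_def A_def add_Suc_right .
qed

text \<open>Absorption turns \<open>(Suc N - j) * (Suc N choose j)\<close> into
  \<open>Suc N * (N choose j)\<close>, after which the sum is the one in
  \<open>alternating_binomial_harmonic\<close>.\<close>

lemma sum_binomial_mult_p_cong:
  assumes "m \<le> N" "m < p"
  shows "Zp_cong p (P ^ 2) (\<Sum>j<m. of_nat (p * Suc N choose (p * j + (m - j))))
    (P * (of_nat (Suc N) * of_nat (N choose m) * (harmonic N - harmonic (N - m))))"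
proof -
  have "Zp_cong p (P ^ 2) (\<Sum>j<m. of_nat (p * Suc N choose (p * j + (m - j))))
    (\<Sum>j<m. P * (of_nat (Suc N) * ((- 1) ^ (m - Suc j) * of_nat (N choose j) / of_nat (m - j))))"
  proof (rule Zp_cong_sum)
    fix j assume "j \<in> {..<m}"
    then obtain i where i: "m = Suc (j + i)" using less_iff_Suc_add by auto
    have "j \<le> Suc N" "Suc i < p" using i assms by auto
    from binomial_mult_p_add_cong[OF this]
    have *: "Zp_cong p (P ^ 2) (of_nat (p * Suc N choose (p * j + Suc i)))
       (P * (of_nat (Suc N choose j) * (of_nat (Suc N) - of_nat j) * ((- 1) ^ i / of_nat (Suc i))))" .
    have "(Suc N - j) * (Suc N choose j) = Suc N * (N choose j)"
      using binomial_absorb_comp[of "Suc N" j] by simp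
    then have "of_nat (Suc N - j) * (of_nat (Suc N choose j) :: rat) = of_nat (Suc N) * of_nat (N choose j)"
      by (metis of_nat_mult)
    then have "of_nat (Suc N choose j) * (of_nat (Suc N) - of_nat j) = of_nat (Suc N) * (of_nat (N choose j) :: rat)"
      using \<open>j \<le> Suc N\<close> by (simp only: of_nat_diff mult.commute)
    moreover have "m - j = Suc i" "m - Suc j = i" using i by auto
    ultimately show "Zp_cong p (P ^ 2) (of_nat (p * Suc N choose (p * j + (m - j))))
      (P * (of_nat (Suc N) * ((- 1) ^ (m - Suc j) * of_nat (N choose j) / of_nat (m - j))))"
      using * by (simp add: mult_ac del: of_nat_Suc)
  qed
  also have "(\<Sum>j<m. P * (of_nat (Suc N) * ((- 1) ^ (m - Suc j) * of_nat (N choose j) / of_nat (m - j))))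
    = P * (of_nat (Suc N) * (of_nat (N choose m) * (harmonic N - harmonic (N - m))))"
    unfolding sum_distrib_left[symmetric] alternating_binomial_harmonic[OF assms(1)] ..
  finally show ?thesis by (simp only: mult.assoc)
qed

end

section \<open>Power sums and the evaluation of the Jacobi sum\<close>

context quartic_character
begin

lemma power_4r_cong_1:
  assumes "\<not> int p dvd t" shows "[t ^ (4 * r) = 1] (mod int p)"
proof -
  obtain k where k: "[t = int g ^ k] (mod int p)" using exists_index[OF assms] by blast
  have "[t ^ (4 * r) = int g ^ (k * (4 * r))] (mod int p)"
    using cong_pow[OF k, of "4 * r"] by (simp only: power_mult)
  moreover have "[int g ^ (k * (4 * r)) = int g ^ 0] (mod int p)"
    unfolding g_power_cong_iff by (simp add: p_eq cong_def)
  ultimately show ?thesis using cong_trans by fastforce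
qed

lemma power_p_cong: "[t ^ p = t] (mod int p)"
proof (cases "int p dvd t")
  case True
  then show ?thesis by (auto simp: cong_iff_dvd_diff intro!: dvd_diff dvd_power_same dvd_trans[OF _ dvd_power])
next
  case False
  from cong_mult[OF power_4r_cong_1[OF this] cong_refl[of t]]
  show ?thesis unfolding p_eq by (simp add: mult.commute)
qed

text \<open>Modulo \<open>p ^ 2\<close> the nonzero \<open>t ^ p\<close> act as roots of unity of
  order dividing \<open>p - 1\<close>. If \<open>p - 1\<close> divides \<open>m\<close>, each of
  them contributes 1; otherwise scaling by \<open>g\<close> multiplies the sum by a number that is
  not 1 modulo \<open>p\<close>.\<close>

lemma sum_power_mult_p_cong:
  assumes "m > 0"
  shows "[(\<Sum>t\<in>{0..<int p}. t ^ (p * m)) = (if 4 * r dvd m then int p - 1 else 0)] (mod int p ^ 2)"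
proof (cases "4 * r dvd m")
  case True
  then obtain l where l: "m = 4 * r * l" by blast
  have "(\<Sum>t\<in>{0..<int p}. t ^ (p * m)) = (\<Sum>t\<in>{0<..<int p}. t ^ (p * m))"
    using assms p_gt_2 by (simp add: range_split)
  also have "[\<dots> = (\<Sum>t\<in>{0<..<int p}. 1)] (mod int p ^ 2)"
  proof (rule cong_sum)
    fix t assume "t \<in> {0<..<int p}"
    from power_4r_cong_1[OF not_dvd_range[OF this]]
    have "[(t ^ (4 * r)) ^ l = 1 ^ l] (mod int p)" by (rule cong_pow)
    then have "[t ^ m = 1] (mod int p)" unfolding l power_mult power_one .
    from cong_power_p[OF this] show "[t ^ (p * m) = 1] (mod int p ^ 2)"
      by (simp add: mult.commute flip: power_mult)
  qed
  finally show ?thesis using True p_gt_2 by simp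
next
  case False
  let ?f = "\<lambda>t. t ^ (p * m) mod int p ^ 2"
  let ?S = "\<Sum>t\<in>{0..<int p}. t ^ (p * m)"
  have g: "\<not> int p dvd int g" using not_dvd_g_power[of 1] unfolding power_one_right .
  have "?f s = ?f t" if "[s = t] (mod int p)" for s t
    using cong_power_p[OF cong_pow[OF that, of m]] by (simp add: cong_def mult.commute flip: power_mult)
  from sum_affine[of ?f, OF this g, of 0]
  have "(\<Sum>t\<in>{0..<int p}. ?f (int g * t + 0)) = (\<Sum>t\<in>{0..<int p}. ?f t)" .
  then have "(\<Sum>t\<in>{0..<int p}. ?f (int g * t + 0)) mod int p ^ 2 = (\<Sum>t\<in>{0..<int p}. ?f t) mod int p ^ 2"
    by simp
  then have "(\<Sum>t\<in>{0..<int p}. (int g * t + 0) ^ (p * m)) mod int p ^ 2 = ?S mod int p ^ 2"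
    by (simp only: mod_sum_eq)
  then have "[int g ^ (p * m) * ?S = ?S] (mod int p ^ 2)"
    by (simp add: cong_def power_mult_distrib sum_distrib_left)
  then have "int p ^ 2 dvd (int g ^ (p * m) - 1) * ?S"
    by (simp add: cong_iff_dvd_diff algebra_simps)
  moreover have "\<not> int p dvd int g ^ (p * m) - 1"
  proof
    assume "int p dvd int g ^ (p * m) - 1"
    then have "[int g ^ (p * m) = int g ^ 0] (mod int p)" by (simp add: cong_iff_dvd_diff)
    then have "4 * r dvd p * m" unfolding g_power_cong_iff by (simp add: p_eq cong_0_iff)
    moreover have "coprime (4 * r) p" unfolding p_eq by (metis add.commute coprime_Suc_right_nat plus_1_eq_Suc coprime_commute)
    ultimately show False using False by (simp add: coprime_dvd_mult_right_iff)
  qed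
  then have "coprime (int p ^ 2) (int g ^ (p * m) - 1)" using prime_p by (simp add: prime_imp_coprime)
  ultimately have "int p ^ 2 dvd ?S" by (simp add: coprime_dvd_mult_right_iff)
  then show ?thesis using False by (simp add: cong_0_iff)
qed

definition unit_root_sum :: int
  where "unit_root_sum = (\<Sum>t\<in>{0..<int p}. t ^ (3 * r * p) * (1 - t) ^ (3 * r * p))"

text \<open>Under an exponent divisible by \<open>p\<close>, \<open>1 - t\<close> may be replaced by
  \<open>1 - t ^ p\<close>, which leaves a polynomial in \<open>t ^ p\<close>. Its power sums
  survive only where \<open>4 * r\<close> divides \<open>3 * r + k\<close>, that is, for
  \<open>k = r + 4 * r * j\<close>.\<close>

lemma unit_root_sum_binomial:
  "[unit_root_sum = (int p - 1) * ((- 1) ^ r * (\<Sum>j\<le>3 * r. int (p * (3 * r) choose (r + 4 * r * j))))] (mod int p ^ 2)"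
proof -
  define N where "N = p * (3 * r)"
  have N: "N = 12 * r * r + 3 * r" unfolding N_def p_eq by (simp add: algebra_simps)
  have "[unit_root_sum = (\<Sum>t\<in>{0..<int p}. t ^ N * (1 - t ^ p) ^ N)] (mod int p ^ 2)"
    unfolding unit_root_sum_def
  proof (rule cong_sum)
    fix t :: int
    have "[1 - t = 1 - t ^ p] (mod int p)" by (rule cong_diff[OF cong_refl cong_sym[OF power_p_cong]])
    from cong_pow[OF cong_power_p[OF this], of "3 * r"]
    have "[(1 - t) ^ (3 * r * p) = (1 - t ^ p) ^ N] (mod int p ^ 2)"
      unfolding N_def by (simp add: mult.commute flip: power_mult)
    then show "[t ^ (3 * r * p) * (1 - t) ^ (3 * r * p) = t ^ N * (1 - t ^ p) ^ N] (mod int p ^ 2)"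
      unfolding N_def by (intro cong_mult) (simp_all add: mult.commute)
  qed
  also have "(\<Sum>t\<in>{0..<int p}. t ^ N * (1 - t ^ p) ^ N)
      = (\<Sum>k\<le>N. (- 1) ^ k * int (N choose k) * (\<Sum>t\<in>{0..<int p}. t ^ (p * (3 * r + k))))"
  proof -
    have "t ^ N * (1 - t ^ p) ^ N = (\<Sum>k\<le>N. (- 1) ^ k * int (N choose k) * t ^ (p * (3 * r + k)))" for t :: int
    proof -
      have "(- (t ^ p) + 1) ^ N = (\<Sum>k\<le>N. int (N choose k) * (- (t ^ p)) ^ k * 1 ^ (N - k))"
        by (rule binomial_ring)
      then have "t ^ N * (1 - t ^ p) ^ N = (\<Sum>k\<le>N. t ^ N * (int (N choose k) * (- (t ^ p)) ^ k))"
        by (simp add: sum_distrib_left)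
      also have "\<dots> = (\<Sum>k\<le>N. (- 1) ^ k * int (N choose k) * t ^ (p * (3 * r + k)))"
      proof (rule sum.cong[OF refl])
        fix k
        have "(- (t ^ p)) ^ k = (- 1) ^ k * t ^ (p * k)"
          unfolding power_minus[of "t ^ p"] by (simp add: power_mult)
        then show "t ^ N * (int (N choose k) * (- (t ^ p)) ^ k) = (- 1) ^ k * int (N choose k) * t ^ (p * (3 * r + k))"
          by (simp add: N_def distrib_left power_add)
      qed
      finally show ?thesis .
    qed
    then show ?thesis by (simp only: sum_distrib_left) (rule sum.swap)
  qed
  also have "[\<dots> = (\<Sum>k\<le>N. (- 1) ^ k * int (N choose k) * (if 4 * r dvd 3 * r + k then int p - 1 else 0))] (mod int p ^ 2)"
    using r_pos by (intro cong_sum cong_mult cong_refl sum_power_mult_p_cong) auto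
  also have "(\<Sum>k\<le>N. (- 1) ^ k * int (N choose k) * (if 4 * r dvd 3 * r + k then int p - 1 else 0))
      = (\<Sum>k\<in>(\<lambda>j. r + 4 * r * j) ` {..3 * r}. (- 1) ^ k * int (N choose k) * (int p - 1))"
  proof (rule sum.mono_neutral_cong_right)
    show "(\<lambda>j. r + 4 * r * j) ` {..3 * r} \<subseteq> {..N}"
    proof (rule image_subsetI)
      fix j assume "j \<in> {..3 * r}"
      then have "4 * r * j \<le> 4 * r * (3 * r)" by (intro mult_le_mono2) simp
      moreover have "4 * r * (3 * r) = 12 * r * r" by simp
      ultimately have "r + 4 * r * j \<le> N" unfolding N by linarith
      then show "r + 4 * r * j \<in> {..N}" by simp
    qed
    have dvd: "4 * r dvd 3 * r + k \<longleftrightarrow> k \<in> (\<lambda>j. r + 4 * r * j) ` {..3 * r}" if "k \<le> N" for k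
    proof
      assume "4 * r dvd 3 * r + k"
      then obtain q where q: "3 * r + k = 4 * r * q" by blast
      then have "q \<noteq> 0" using r_pos by (intro notI) simp
      then obtain j where j: "q = Suc j" using not0_implies_Suc by blast
      then have k: "k = r + 4 * r * j" using q by simp
      \<comment> \<open>The next index \<open>j = 3 * r + 1\<close> would need
        \<open>12 * r * r + 5 * r \<le> N\<close>.\<close>
      have "\<not> 3 * r + 1 \<le> j"
      proof
        assume "3 * r + 1 \<le> j"
        then have "4 * r * (3 * r + 1) \<le> 4 * r * j" by (intro mult_left_mono) auto
        then show False using that k r_pos unfolding N by (simp add: algebra_simps)
      qed
      then show "k \<in> (\<lambda>j. r + 4 * r * j) ` {..3 * r}" using k by auto
    next
      assume "k \<in> (\<lambda>j. r + 4 * r * j) ` {..3 * r}"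
      then obtain j where "k = r + 4 * r * j" by blast
      then have "3 * r + k = 4 * r * (j + 1)" by (simp add: algebra_simps)
      then show "4 * r dvd 3 * r + k" by simp
    qed
    show "\<forall>k\<in>{..N} - (\<lambda>j. r + 4 * r * j) ` {..3 * r}. (- 1) ^ k * int (N choose k) * (if 4 * r dvd 3 * r + k then int p - 1 else 0) = 0"
      using dvd by auto
    show "(- 1) ^ k * int (N choose k) * (if 4 * r dvd 3 * r + k then int p - 1 else 0) = (- 1) ^ k * int (N choose k) * (int p - 1)"
      if "k \<in> (\<lambda>j. r + 4 * r * j) ` {..3 * r}" for k
      using that by auto
  qed simp
  also have "\<dots> = (\<Sum>j\<le>3 * r. (- 1) ^ (r + 4 * r * j) * int (N choose (r + 4 * r * j)) * (int p - 1))"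
    using r_pos by (subst sum.reindex) (auto simp: inj_on_def)
  also have "\<dots> = (int p - 1) * ((- 1) ^ r * (\<Sum>j\<le>3 * r. int (N choose (r + 4 * r * j))))"
  proof -
    have "(- 1 :: int) ^ (r + 4 * r * j) = (- 1) ^ r" for j by (simp add: power_add minus_one_power_iff)
    then show ?thesis by (simp only: sum_distrib_left mult_ac)
  qed
  finally show ?thesis unfolding N_def .
qed

text \<open>Since \<open>4 * r = p - 1\<close>, the lower index is \<open>p * j + (r - j)\<close>.
  The term \<open>j = r\<close> gives the leading binomial coefficient; the terms on either side of
  it are multiples of \<open>p\<close> that add up to harmonic numbers.\<close>

lemma approx1_unit_root_sum:
  "approx1 (of_int unit_root_sum) ((- 1) ^ Suc r * of_nat (3 * r choose r)) ((harmonic (2 * r) - harmonic r) / 2)"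
proof -
  define B :: rat where "B = of_nat (3 * r choose r)"
  define N where "N = 3 * r - 1"
  have N: "3 * r = Suc N" "r \<le> N" "2 * r \<le> N" "N - r = 2 * r - 1" "N - 2 * r = r - 1"
    using r_pos unfolding N_def by auto
  have lt: "r < p" "2 * r < p" "3 * r < p" using p_eq by auto
  define e where "e = 2 * of_nat r * (harmonic N - harmonic (2 * r - 1)) + of_nat r * (harmonic N - harmonic (r - 1))"
  have absorb: "of_nat (Suc N) * of_nat (N choose m) = of_nat (3 * r - m) * (of_nat (3 * r choose m) :: rat)" for m
  proof -
    have "(3 * r - m) * (3 * r choose m) = Suc N * (N choose m)"
      using binomial_absorb_comp[of "Suc N" m] N(1) by simp
    then show ?thesis by (metis of_nat_mult)
  qed
  have T1: "Zp_cong p (P ^ 2) (\<Sum>j<r. of_nat (p * (3 * r) choose (p * j + (r - j))))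
      (P * (2 * of_nat r * B * (harmonic N - harmonic (2 * r - 1))))"
    using sum_binomial_mult_p_cong[OF N(2) lt(1)] unfolding absorb[of r] unfolding N(1)[symmetric] N(4) B_def by simp
  have "(3 * r choose (2 * r)) = (3 * r choose r)" by (subst binomial_symmetric) auto
  then have T2: "Zp_cong p (P ^ 2) (\<Sum>j<2 * r. of_nat (p * (3 * r) choose (p * j + (2 * r - j))))
      (P * (of_nat r * B * (harmonic N - harmonic (r - 1))))"
    using sum_binomial_mult_p_cong[OF N(3) lt(2)] unfolding absorb[of "2 * r"] unfolding N(1)[symmetric] N(5) B_def by simp
  have T0: "Zp_cong p (P ^ 2) (of_nat (p * (3 * r) choose (p * r))) B"
    unfolding B_def by (rule binomial_mult_p_cong) simp
  have "(\<Sum>j\<le>3 * r. of_nat (p * (3 * r) choose (r + 4 * r * j)) :: rat)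
      = (\<Sum>j<r. of_nat (p * (3 * r) choose (p * j + (r - j)))) + of_nat (p * (3 * r) choose (p * r))
        + (\<Sum>j<2 * r. of_nat (p * (3 * r) choose (p * j + (2 * r - j))))" (is "_ = ?S1 + ?S0 + ?S2")
  proof -
    let ?f = "\<lambda>j. of_nat (p * (3 * r) choose (r + 4 * r * j)) :: rat"
    have "{..3 * r} = {..<r} \<union> {r} \<union> {r<..3 * r}" by auto
    then have "sum ?f {..3 * r} = sum ?f ({..<r} \<union> {r} \<union> {r<..3 * r})" by simp
    also have "\<dots> = sum ?f ({..<r} \<union> {r}) + sum ?f {r<..3 * r}" by (rule sum.union_disjoint) auto
    also have "sum ?f ({..<r} \<union> {r}) = sum ?f {..<r} + sum ?f {r}" by (rule sum.union_disjoint) auto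
    also have "sum ?f {..<r} = ?S1"
    proof (rule sum.cong[OF refl])
      fix j assume "j \<in> {..<r}"
      then have "r + 4 * r * j = p * j + (r - j)" unfolding p_eq by (simp add: algebra_simps)
      then show "?f j = of_nat (p * (3 * r) choose (p * j + (r - j)))" by simp
    qed
    also have "sum ?f {r} = ?S0"
    proof -
      have "r + 4 * r * r = p * r" unfolding p_eq by (simp add: algebra_simps)
      then show ?thesis by simp
    qed
    \<comment> \<open>For \<open>j > r\<close> the offset \<open>r - j\<close> is negative. Symmetry
      of the binomial coefficient together with \<open>3 * r - j\<close> in place of
      \<open>j\<close> makes the offset \<open>2 * r - j\<close>.\<close>
    also have "sum ?f {r<..3 * r} = ?S2"
    proof (rule sum.reindex_bij_witness[of _ "\<lambda>j. 3 * r - j" "\<lambda>j. 3 * r - j"])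
      fix j assume j: "j \<in> {r<..3 * r}"
      then obtain i where i: "3 * r = j + i" using le_Suc_ex by auto
      have "i \<le> 2 * r" using i j by auto
      then obtain l where l: "2 * r = i + l" using le_Suc_ex by auto
      have "p * (3 * r) = (r + 4 * r * j) + (p * i + l)"
      proof -
        have "p * (3 * r) = 4 * r * j + (4 * r * i + 3 * r)" unfolding p_eq i by (simp add: algebra_simps)
        also have "4 * r * i + 3 * r = r + (p * i + l)" unfolding p_eq using l by (simp add: algebra_simps)
        finally show ?thesis by simp
      qed
      then have "(p * (3 * r) choose (r + 4 * r * j)) = (p * (3 * r) choose (p * i + l))"
        by (metis add_diff_cancel_left' binomial_symmetric le_add1)
      moreover have "3 * r - j = i" "2 * r - i = l" using i l by auto
      ultimately show "of_nat (p * (3 * r) choose (p * (3 * r - j) + (2 * r - (3 * r - j)))) = ?f j"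
        by simp
    qed auto
    finally show ?thesis .
  qed
  also have "Zp_cong p (P ^ 2) \<dots> (P * (2 * of_nat r * B * (harmonic N - harmonic (2 * r - 1))) + B
      + P * (of_nat r * B * (harmonic N - harmonic (r - 1))))"
    by (intro Zp_cong_add T0 T1 T2)
  also have "\<dots> = B * (1 + P * e)" unfolding e_def by (simp add: algebra_simps)
  finally have S: "Zp_cong p (P ^ 2) (\<Sum>j\<le>3 * r. of_nat (p * (3 * r) choose (r + 4 * r * j))) (B * (1 + P * e))" .
  have "Zp_cong p (P ^ 2) (of_int unit_root_sum)
      (of_int ((int p - 1) * ((- 1) ^ r * (\<Sum>j\<le>3 * r. int (p * (3 * r) choose (r + 4 * r * j))))))"
    unfolding Zp_cong_of_int by (rule unit_root_sum_binomial)
  also have "of_int ((int p - 1) * ((- 1) ^ r * (\<Sum>j\<le>3 * r. int (p * (3 * r) choose (r + 4 * r * j)))))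
     = (P - 1) * ((- 1) ^ r * (\<Sum>j\<le>3 * r. of_nat (p * (3 * r) choose (r + 4 * r * j))))"
    by simp
  also have "Zp_cong p (P ^ 2) \<dots> ((P - 1) * ((- 1) ^ r * (B * (1 + P * e))))"
    by (intro Zp_cong_mult S Zp_cong_refl) auto
  \<comment> \<open>Writing \<open>P - 1\<close> as \<open>- (1 + P * (- 1))\<close> gives the extra
    sign and the exponent \<open>- 1\<close>, which later cancels the constant 1 in
    \<open>e\<close>.\<close>
  also have "(P - 1) * ((- 1) ^ r * (B * (1 + P * e))) = (- 1) ^ Suc r * B * ((1 + P * e) * (1 + P * (- 1)))"
    by (simp add: algebra_simps)
  finally have U: "Zp_cong p (P ^ 2) (of_int unit_root_sum) ((- 1) ^ Suc r * B * ((1 + P * e) * (1 + P * (- 1))))" .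
  have harm: "harmonic N = harmonic (3 * r) - 1 / (3 * of_nat r)" "harmonic (2 * r - 1) = harmonic (2 * r) - 1 / (2 * of_nat r)"
     "harmonic (r - 1) = harmonic r - 1 / of_nat r"
  proof -
    have *: "harmonic (m - 1) = harmonic m - 1 / of_nat m" if "m > 0" for m
      using harmonic_Suc[of "m - 1"] that by simp
    show "harmonic N = harmonic (3 * r) - 1 / (3 * of_nat r)" "harmonic (2 * r - 1) = harmonic (2 * r) - 1 / (2 * of_nat r)"
      "harmonic (r - 1) = harmonic r - 1 / of_nat r"
      unfolding N_def using *[of "3 * r"] *[of "2 * r"] *[of r] r_pos by simp_all
  qed
  have e: "e = 3 * of_nat r * harmonic (3 * r) - 2 * of_nat r * harmonic (2 * r) - of_nat r * harmonic r + 1"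
    unfolding e_def harm using r_pos by (simp add: field_simps)
  have hm: "harmonic (3 * r) \<in> Zp p" "harmonic (2 * r) \<in> Zp p" "harmonic r \<in> Zp p" using lt by auto
  then have eZ: "e \<in> Zp p" unfolding e by simp
  have "p - 1 - r = 3 * r" using p_eq by simp
  then have "Zp_cong p P (harmonic (3 * r)) (harmonic r)" using harmonic_reflect[OF lt(1)] by simp
  then have "Zp_cong p P e (3 * of_nat r * harmonic r - 2 * of_nat r * harmonic (2 * r) - of_nat r * harmonic r + 1)"
    unfolding e using hm by (intro Zp_cong_add Zp_cong_diff Zp_cong_mult Zp_cong_refl) auto
  \<comment> \<open>Modulo \<open>p\<close> the number \<open>4 * r\<close> is \<open>- 1\<close>,
    which removes \<open>r\<close> from the coefficients.\<close>
  also have "Zp_cong p P \<dots> ((harmonic (2 * r) - harmonic r) / 2 + 1)"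
  proof (rule Zp_cong_I)
    have "P = 4 * of_nat r + 1" unfolding p_eq by simp
    then show "3 * of_nat r * harmonic r - 2 * of_nat r * harmonic (2 * r) - of_nat r * harmonic r + 1
      - ((harmonic (2 * r) - harmonic r) / 2 + 1) = P * ((harmonic r - harmonic (2 * r)) / 2)"
      by (simp add: field_simps)
  qed (use hm in simp_all)
  finally have e': "Zp_cong p P e ((harmonic (2 * r) - harmonic r) / 2 + 1)" .
  have B: "Zp_unit ((- 1) ^ Suc r * B)"
  proof -
    have "B = fact (3 * r) / (fact r * fact (2 * r))" unfolding B_def by (simp add: binomial_fact)
    then have "Zp_unit B" using lt by (simp only:) (intro unit_divide unit_mult unit_fact)
    then show ?thesis by (intro unit_mult unit_power) auto
  qed
  have "approx1 (1 + P * (- 1)) 1 (- 1)" by (rule approx1_one_plus) simp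
  from approx1_mult[OF approx1_refl[OF B] approx1_mult[OF approx1_cong[OF approx1_one_plus[OF eZ] e'] this]]
  have "approx1 ((- 1) ^ Suc r * B * ((1 + P * e) * (1 + P * (- 1)))) ((- 1) ^ Suc r * B) ((harmonic (2 * r) - harmonic r) / 2)"
    by simp
  with U show ?thesis unfolding B_def by (rule approx1_cong_left)
qed

text \<open>Reflection at \<open>r\<close> and at \<open>2 * r\<close>, which is its own mirror
  index, rewrites the squared binomial coefficient; the terms in \<open>harmonic (2 * r)\<close>
  cancel.\<close>

lemma approx1_unit_root_sum_square:
  "approx1 (of_int unit_root_sum ^ 2) (fact (p - 1) / fact r ^ 4) (harmonic r)"
proof -
  have lt: "r < p" "2 * r < p" and e: "p - 1 - r = 3 * r" "p - 1 - 2 * r = 2 * r" using p_eq by auto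
  have 1: "approx1 ((- 1) ^ r * (fact (3 * r) * fact r)) (fact (p - 1)) (harmonic r)"
    using approx1_sym[OF approx1_fact_reflect[OF lt(1)]] unfolding e by simp
  have 2: "approx1 (fact (2 * r) * fact (2 * r)) (fact (p - 1)) (harmonic (2 * r))"
    using approx1_sym[OF approx1_fact_reflect[OF lt(2)]] unfolding e by simp
  have ur: "Zp_unit (fact r ^ 4)" by (intro unit_power unit_fact lt)
  have "approx1 (((- 1) ^ r * (fact (3 * r) * fact r)) ^ 2 / (fact (2 * r) * fact (2 * r)) / fact r ^ 4)
      (fact (p - 1) ^ 2 / fact (p - 1) / fact r ^ 4) (of_nat 2 * harmonic r - harmonic (2 * r) - 0)"
    by (intro approx1_div approx1_power approx1_refl 1 2 ur)
  moreover have "((- 1) ^ r * (fact (3 * r) * fact r)) ^ 2 / (fact (2 * r) * fact (2 * r)) / fact r ^ 4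
      = ((- 1) ^ Suc r * of_nat (3 * r choose r) :: rat) ^ 2"
    by (simp add: binomial_fact power_mult_distrib power_divide eval_nat_numeral mult_ac)
  moreover have "fact (p - 1) ^ 2 / fact (p - 1) / fact r ^ 4 = (fact (p - 1) / fact r ^ 4 :: rat)"
    by (simp add: power2_eq_square)
  ultimately have "approx1 (((- 1) ^ Suc r * of_nat (3 * r choose r)) ^ 2) (fact (p - 1) / fact r ^ 4)
      (of_nat 2 * harmonic r - harmonic (2 * r) - 0)" by (simp only:)
  from approx1_trans[OF approx1_power[OF approx1_unit_root_sum, of 2] this]
  show ?thesis by (rule approx1_eqI) (simp_all add: field_simps)
qed

lemma unit_root_sum_square_cong:
  assumes "int p = x ^ 2 + y ^ 2" "odd x"
  shows "Zp_cong p (P ^ 2) (of_int unit_root_sum ^ 2) (of_int (4 * x ^ 2 - 2 * int p))"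
proof -
  have "Zp_unit (of_int unit_root_sum)" using approx1_unit_root_sum unfolding approx1_def by blast
  then have "\<not> int p dvd unit_root_sum" by (rule unit_not_dvd)
  from jacobi_sum_square_cong[OF this[unfolded unit_root_sum_def] assms]
  have "[unit_root_sum ^ 2 = 4 * x ^ 2 - 2 * int p] (mod int p ^ 2)" unfolding unit_root_sum_def .
  then show ?thesis unfolding Zp_cong_of_int[symmetric] by simp
qed

end

section \<open>Combination of the two evaluations\<close>

lemma Legendre_3_eq:
  assumes "p mod 12 = 1 \<or> p mod 12 = 5"
  shows "Legendre (int p) 3 = (if p mod 12 = 1 then 1 else - 1)"
proof (cases "p mod 12 = 1")
  case True
  then have p: "int p mod 3 = 1" by presburger
  then have "QuadRes 3 (int p)" unfolding QuadRes_def by (intro exI[of _ 1]) (simp add: cong_def)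
  then show ?thesis using True p unfolding Legendre_def cong_def by simp
next
  case False
  then have p: "int p mod 3 = 2" using assms by presburger
  have "\<not> QuadRes 3 (int p)"
  proof
    assume "QuadRes 3 (int p)"
    then obtain y where "y ^ 2 mod 3 = int p mod 3" unfolding QuadRes_def cong_def by blast
    then have "(y mod 3) ^ 2 mod 3 = 2" using p by (simp add: power_mod)
    moreover have "y mod 3 = 0 \<or> y mod 3 = 1 \<or> y mod 3 = 2" by presburger
    ultimately show False by auto
  qed
  then show ?thesis using False p unfolding Legendre_def cong_def by simp
qed

context odd_prime
begin

text \<open>One statement covers both sums: \<open>e * p\<close> is the multiple of \<open>p\<close>
  congruent to \<open>b\<close> modulo 12. For \<open>p\<close> congruent to 1 the pairs
  \<open>(e, b)\<close> are \<open>(1, 1)\<close> and \<open>(5, 5)\<close>; for 5 they are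
  \<open>(1, 5)\<close> and \<open>(5, 1)\<close>.\<close>

lemma weighted_sum_cong:
  fixes x y :: int
  assumes p12: "p mod 12 = 1 \<or> p mod 12 = 5"
    and em: "e = 1 \<and> m = p div 12 \<or> e = 5 \<and> m = 5 * p div 12" "e * p = 12 * m + b" "b \<noteq> 0" "b \<le> 5"
    and xy: "int p = x ^ 2 + y ^ 2" "odd x"
  shows "Zp_cong p (P ^ 2)
    (of_int (Legendre (int p) 3) * (of_nat e * (\<Sum>k = 0..p - 1. of_nat (2 * k choose k) ^ 2 * (1 / 16 ^ k) * (P / of_nat (12 * k + b)))))
    (of_int (4 * x ^ 2 - 2 * int p))" (is "Zp_cong p _ (of_int ?L * ?T) _")
proof -
  define r s S n where "r = p div 4" and "s = p div 12" and "S = 5 * p div 12" and "n = 2 * r"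
  have "p = 12 * s + 1 \<or> p = 12 * s + 5" using p12 unfolding s_def by presburger
  then have cases: "p = 12 * s + 1 \<and> r = 3 * s \<and> S = 5 * s \<or> p = 12 * s + 5 \<and> r = 3 * s + 1 \<and> S = 5 * s + 2"
  proof (elim disjE)
    assume p: "p = 12 * s + 1"
    then have "r = 3 * s" "S = 5 * s" unfolding r_def S_def by presburger+
    then show ?thesis using p by simp
  next
    assume p: "p = 12 * s + 5"
    then have "r = 3 * s + 1" "S = 5 * s + 2" unfolding r_def S_def by presburger+
    then show ?thesis using p by simp
  qed
  have p3: "p \<noteq> 3" using p12 by auto
  have pr: "p = 4 * r + 1" and n: "p = 2 * n + 1" "even n" and sS: "s + S = n" using cases unfolding n_def by auto
  have mn: "m = s \<and> n - m = S \<and> e = 1 \<or> m = S \<and> n - m = s \<and> e = 5"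
    using em(1) sS unfolding s_def[symmetric] S_def[symmetric] by auto
  have "p = 5 \<or> p \<ge> 13" using cases p_gt_2 by (cases s) auto
  have integral: "of_nat e * (P / of_nat (12 * k + b)) \<in> Zp p" if k: "k < p" for k
  proof (cases "p dvd 12 * k + b")
    case False
    then show ?thesis by (intro Zp_mult unit_div unit_of_nat Zp_of_nat)
  next
    case True
    then obtain q where q: "12 * k + b = p * q" by blast
    have q0: "q \<noteq> 0" using q em(3) by (intro notI) simp
    have val: "of_nat e * (P / of_nat (12 * k + b)) = of_nat e / of_nat q" unfolding q by simp
    show ?thesis
    proof (cases "p = 5")
      case True
      \<comment> \<open>For \<open>p = 5\<close>, \<open>b = 1\<close> and \<open>k = 2\<close> the
        denominator is 25; the factor \<open>e = 5\<close> absorbs the second 5.\<close>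
      then have "e = 1 \<and> b = 5 \<or> e = 5 \<and> b = 1" using em by auto
      moreover have "k < 5" "12 * k + b = 5 * q" using k q True by auto
      then have "b = 5 \<Longrightarrow> q = 1" "b = 1 \<Longrightarrow> q = 5" by presburger+
      ultimately have "q = 1 \<or> q = 5 \<and> e = 5" by blast
      then show ?thesis unfolding val by auto
    next
      case False
      then have "p \<ge> 13" using \<open>p = 5 \<or> p \<ge> 13\<close> by simp
      \<comment> \<open>The denominator stays below \<open>13 * p\<close>, so it contains only one
        factor \<open>p\<close>.\<close>
      have "q < p"
      proof (rule ccontr)
        assume "\<not> q < p"
        then have "p * 13 \<le> p * q" using \<open>p \<ge> 13\<close> by (intro mult_left_mono) auto
        then show False using q k em(4) by linarith
      qed
      then show ?thesis unfolding val using q0 by (intro unit_div unit_of_nat_less Zp_of_nat) auto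
    qed
  qed
  have T: "approx1 ?T (fact (p - 1) / (fact m * fact (n - m)) ^ 2)
      (harmonic (n - m) - of_nat e / 6 * (harmonic (n - m) - harmonic m))"
    using mn sS by (intro sum_cong_partial_fractions[OF n _ em(2) _ p3 em(3) integral]) auto
  \<comment> \<open>Exchanging \<open>m\<close> with \<open>n - m\<close> and \<open>e = 1\<close>
    with \<open>e = 5\<close> swaps the weights 1/6 and 5/6, so both choices lead to the same
    expansion.\<close>
  then have T: "approx1 ?T (fact (p - 1) / (fact s * fact S) ^ 2) (harmonic s / 6 + 5 * harmonic S / 6)"
    by (rule approx1_eqI) (use mn in \<open>auto simp: field_simps\<close>)
  obtain g where "residue_primroot p g" using prime_primitive_root_exists[OF _ prime_p] p_gt_2 by auto
  then interpret quartic_character p r g by unfold_locales (rule pr)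
  have "?L = 1 \<or> ?L = - 1"
    by (simp add: Legendre_3_eq[OF p12])
  then have uL: "Zp_unit (of_int ?L)" and LL: "of_int ?L * of_int ?L = (1 :: rat)" by auto
  have uf: "Zp_unit (fact (p - 1))" "Zp_unit (fact s)" "Zp_unit (fact S)" using cases by (auto intro!: unit_fact)
  \<comment> \<open>The terms in \<open>harmonic r\<close> cancel, and what remains is the expansion
    of the weighted sum.\<close>
  have "approx1 (of_int unit_root_sum ^ 2) (fact (p - 1) / (of_int ?L * (fact s * fact S) ^ 2))
      (harmonic r + (0 - (harmonic r - harmonic s / 6 - 5 * harmonic S / 6)))"
    using approx1_trans[OF approx1_unit_root_sum_square approx1_div[OF approx1_refl[OF uf(1)]
        approx1_fact_quarter[OF p12, folded r_def s_def S_def]]] .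
  note U = approx1_sym[OF this]
  have "of_int ?L * (fact (p - 1) / (fact s * fact S) ^ 2) = fact (p - 1) / (of_int ?L * (fact s * fact S :: rat) ^ 2)"
    using \<open>?L = 1 \<or> ?L = - 1\<close> by auto
  then have "approx1 (of_int ?L * ?T) (fact (p - 1) / (of_int ?L * (fact s * fact S) ^ 2))
      (0 + (harmonic s / 6 + 5 * harmonic S / 6))"
    using approx1_mult[OF approx1_refl[OF uL] T] by (simp only:)
  from approx1_trans[OF this U]
  have "approx1 (of_int ?L * ?T) (of_int unit_root_sum ^ 2) 0" by simp
  from Zp_cong_trans[OF approx1_0_cong[OF this] unit_root_sum_square_cong[OF xy]] show ?thesis .
qed

end

theorem theorem4p4:
  fixes p :: nat and x y :: int
  assumes "prime p"
    and "[p = 1] (mod 4)"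
    and "int p = x ^ 2 + y ^ 2"
    and "odd x"
  shows "Zp_cong p ((of_nat p) ^ 2)
           ((3 * of_int (Legendre (int p) 3) - 2) *
              (\<Sum>k = 0..p - 1. (of_nat ((2 * k) choose k)) ^ 2 * (1 / 16 ^ k) *
                 (of_nat p / of_nat (12 * k + 1))))
           ((3 * of_int (Legendre (int p) 3) + 2) *
              (\<Sum>k = 0..p - 1. (of_nat ((2 * k) choose k)) ^ 2 * (1 / 16 ^ k) *
                 (of_nat p / of_nat (12 * k + 5))))
       \<and> Zp_cong p ((of_nat p) ^ 2)
           ((3 * of_int (Legendre (int p) 3) + 2) *
              (\<Sum>k = 0..p - 1. (of_nat ((2 * k) choose k)) ^ 2 * (1 / 16 ^ k) *
                 (of_nat p / of_nat (12 * k + 5))))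
           (of_int (4 * x ^ 2 - 2 * int p))"
proof -
  have p4: "p mod 4 = 1" using assms(2) by (simp add: cong_def)
  then have "odd p" by presburger
  then interpret odd_prime p using assms(1) by unfold_locales
  have "p \<noteq> 3" using p4 by auto
  then have "\<not> 3 dvd p" using assms(1) by (auto simp: prime_nat_iff)
  then have p12: "p mod 12 = 1 \<or> p mod 12 = 5" using p4 by presburger
  define s where "s = p div 12"
  define L where "L = Legendre (int p) 3"
  define T :: "nat \<Rightarrow> rat"
    where "T b = (\<Sum>k = 0..p - 1. (of_nat ((2 * k) choose k)) ^ 2 * (1 / 16 ^ k) * (of_nat p / of_nat (12 * k + b)))" for b
  have W: "Zp_cong p (P ^ 2) (of_int L * (of_nat e * T b)) (of_int (4 * x ^ 2 - 2 * int p))"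
    if "e = 1 \<and> m = p div 12 \<or> e = 5 \<and> m = 5 * p div 12" "e * p = 12 * m + b" "b \<noteq> 0" "b \<le> 5" for e m b
    unfolding L_def T_def by (rule weighted_sum_cong[OF p12 that assms(3,4)])
  have "Zp_cong p (P ^ 2) ((3 * of_int L - 2) * T 1) (of_int (4 * x ^ 2 - 2 * int p)) \<and>
    Zp_cong p (P ^ 2) ((3 * of_int L + 2) * T 5) (of_int (4 * x ^ 2 - 2 * int p))"
  \<comment> \<open>The multipliers \<open>3 * L - 2\<close> and \<open>3 * L + 2\<close> are the
    products \<open>L * e\<close>: 1 and 5 for \<open>L = 1\<close>, \<open>- 5\<close> and
    \<open>- 1\<close> for \<open>L = - 1\<close>.\<close>
  proof (cases "p mod 12 = 1")
    case True
    then have s: "p = 12 * s + 1" unfolding s_def by presburger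
    then have "5 * p div 12 = 5 * s" by presburger
    then have "Zp_cong p (P ^ 2) (of_int L * (of_nat 1 * T 1)) (of_int (4 * x ^ 2 - 2 * int p))"
      "Zp_cong p (P ^ 2) (of_int L * (of_nat 5 * T 5)) (of_int (4 * x ^ 2 - 2 * int p))"
      using W[of 1 s 1] W[of 5 "5 * s" 5] s by (simp_all add: s_def[symmetric])
    moreover have "L = 1" unfolding L_def Legendre_3_eq[OF p12] using True by simp
    ultimately show ?thesis by simp
  next
    case False
    then have s: "p = 12 * s + 5" using p12 unfolding s_def by presburger
    then have "5 * p div 12 = 5 * s + 2" by presburger
    then have "Zp_cong p (P ^ 2) (of_int L * (of_nat 5 * T 1)) (of_int (4 * x ^ 2 - 2 * int p))"
      "Zp_cong p (P ^ 2) (of_int L * (of_nat 1 * T 5)) (of_int (4 * x ^ 2 - 2 * int p))"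
      using W[of 5 "5 * s + 2" 1] W[of 1 s 5] s by (simp_all add: s_def[symmetric])
    moreover have "L = - 1" unfolding L_def Legendre_3_eq[OF p12] using False by simp
    ultimately show ?thesis by simp
  qed
  then show ?thesis unfolding L_def T_def using Zp_cong_sym Zp_cong_trans by blast
qed

end
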